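(* Let $u\in \mathrm{BMOA}_{\mathrm{simp}}(\mathbb T)$, i.e. $u\in\mathrm{BMOA}(\mathbb T)$ and both self-adjoint operators $(H_u^{\mathrm e})^2$ and $(\widetilde H_u^{\mathrm e})^2$ have simple spectra. Then $u$ is a cyclic element for both $(H_u^{\mathrm e})^2$ and $(\widetilde H_u^{\mathrm e})^2$, i.e. $$\langle u\rangle_{H_u^2}=\langle u\rangle_{\widetilde H_u^2}=\overline{\mathrm{Ran}}\,H_u .$$
   Context: $H^2=H^2(\mathbb T)$ is the Hardy space on the unit circle, $z^0$ is the constant function $1$, $P:L^2(\mathbb T)\to H^2$ is the orthogonal projection, $S$ is the shift operator $Sf(z)=zf(z)$ on $H^2$ and $S^*$ is its adjoint. For $u\in\mathrm{BMOA}(\mathbb T)$, $H_u$ is the bounded anti-linear Hankel operator on $H^2$ given by $H_uf=P(u\overline f)$ (initially on polynomials $f$), and $\widetilde H_u:=S^*H_u=H_uS=H_{S^*u}$. The operators $H_u^2$ and $\widetilde H_u^2$ are linear, bounded and positive semi-definite, and $u=H_uz^0$. $\overline{\mathrm{Ran}}\,H_u$ denotes the closure of the range of $H_u$; it equals $(\mathrm{Ker}\, H_u)^\perp$ and is invariant under $H_u$, $S^*$ and $\widetilde H_u$. Define the essential parts $$H_u^{\mathrm e}:=H_u|_{\overline{\mathrm{Ran}}\,H_u},\qquad \widetilde H_u^{\mathrm e}:=\widetilde H_u|_{\overline{\mathrm{Ran}}\,H_u}$$ (both restrictions are to the closure of the range of $H_u$). For a bounded self-adjoint operator $A$ on a Hilbert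 space $X$ and $v\in X$, $\langle v\rangle_A$ is the closed linear span of $\{A^nv:\ n=0,1,2,\dots\}$; $A$ has simple spectrum if $X=\langle v\rangle_A$ for some $v\in X$, and any such $v$ is called cyclic for $A$. *)

theory Defs
  imports "HOL-Analysis.Analysis"
begin

text \<open>Normalised arc length measure, carried by the unit circle of the complex plane.\<close>

definition circle :: "complex measure" where
  "circle = distr (uniform_measure lborel {0..2*pi}) borel cis"

lemma cis_measurable [measurable]: "cis \<in> borel_measurable borel"
  by (intro borel_measurable_continuous_onI continuous_intros)

lemma cnj_measurable [measurable]: "cnj \<in> borel_measurable borel"
  by (intro borel_measurable_continuous_onI continuous_intros)

lemma sets_circle [simp, measurable_cong]: "sets circle = sets borel"
  by (simp add: circle_def)

lemma space_circle [simp]: "space circle = UNIV"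
  by (simp add: circle_def)

lemma prob_space_circle: "emeasure circle (space circle) = 1"
proof -
  have "cis \<in> measurable (uniform_measure lborel {0..2*pi}) borel"
    by measurable
  moreover have "emeasure (uniform_measure lborel {0..2*pi}) UNIV = 1"
    by (simp add: divide_ennreal)
  ultimately show ?thesis
    by (simp add: circle_def emeasure_distr)
qed

lemma finite_measure_circle: "finite_measure circle"
  by (rule finite_measureI) (simp only: prob_space_circle, simp)

lemma AE_circle_norm: "AE z in circle. norm z = 1"
proof -
  have "AE z in distr (uniform_measure lborel {0..2*pi}) borel cis. norm z = 1"
  proof (subst AE_distr_iff)
    have "closed {z :: complex. norm z = 1}"
      by (intro closed_Collect_eq continuous_intros)
    then show "{z \<in> space borel. norm z = 1} \<in> sets (borel :: complex measure)"
      by (simp add: borel_closed)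
  qed auto
  then show ?thesis by (simp only: circle_def)
qed

definition square_integrable :: "(complex \<Rightarrow> complex) \<Rightarrow> bool" where
  "square_integrable f \<longleftrightarrow> f \<in> borel_measurable circle \<and> integrable circle (\<lambda>z. (norm (f z))\<^sup>2)"

definition l2_rel :: "(complex \<Rightarrow> complex) \<Rightarrow> (complex \<Rightarrow> complex) \<Rightarrow> bool" where
  "l2_rel f g \<longleftrightarrow> square_integrable f \<and> square_integrable g \<and> (AE z in circle. f z = g z)"

lemma part_equivp_l2_rel: "part_equivp l2_rel"
proof (rule part_equivpI)
  show "\<exists>f. l2_rel f f"
    by (rule exI[of _ "\<lambda>_. 0"]) (simp add: l2_rel_def square_integrable_def)
  show "symp l2_rel"
    by (auto simp: symp_def l2_rel_def)
  show "transp l2_rel"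
    unfolding transp_def l2_rel_def by auto
qed

quotient_type l2 = "complex \<Rightarrow> complex" / partial: l2_rel
  by (rule part_equivp_l2_rel)

lemma square_integrable_add:
  assumes "square_integrable f" "square_integrable g"
  shows "square_integrable (\<lambda>z. f z + g z)"
proof -
  have [measurable]: "f \<in> borel_measurable circle" "g \<in> borel_measurable circle"
    using assms by (auto simp: square_integrable_def)
  have "integrable circle (\<lambda>z. (norm (f z + g z))\<^sup>2)"
  proof (rule Bochner_Integration.integrable_bound)
    show "integrable circle (\<lambda>z. 2 * (norm (f z))\<^sup>2 + 2 * (norm (g z))\<^sup>2)"
      using assms by (auto simp: square_integrable_def)
    have "(norm (f z + g z))\<^sup>2 \<le> 2 * (norm (f z))\<^sup>2 + 2 * (norm (g z))\<^sup>2" for z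
    proof -
      have "(norm (f z + g z))\<^sup>2 \<le> (norm (f z) + norm (g z))\<^sup>2"
        by (intro power_mono norm_triangle_ineq) auto
      also have "\<dots> \<le> 2 * (norm (f z))\<^sup>2 + 2 * (norm (g z))\<^sup>2"
        using sum_squares_bound[of "norm (f z)" "norm (g z)"] by (simp add: power2_sum)
      finally show ?thesis .
    qed
    then show "AE z in circle. norm ((norm (f z + g z))\<^sup>2)
        \<le> norm (2 * (norm (f z))\<^sup>2 + 2 * (norm (g z))\<^sup>2)"
      by auto
  qed measurable
  then show ?thesis by (simp add: square_integrable_def)
qed

lemma square_integrable_bounded_mult:
  assumes "square_integrable f" "g \<in> borel_measurable borel" "AE z in circle. norm (g z) \<le> C"
  shows "square_integrable (\<lambda>z. f z * g z)"
proof -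
  have [measurable]: "f \<in> borel_measurable circle" "g \<in> borel_measurable borel"
    using assms by (auto simp: square_integrable_def)
  have "integrable circle (\<lambda>z. (norm (f z * g z))\<^sup>2)"
  proof (rule Bochner_Integration.integrable_bound)
    show "integrable circle (\<lambda>z. C\<^sup>2 * (norm (f z))\<^sup>2)"
      using assms by (auto simp: square_integrable_def)
    show "AE z in circle. norm ((norm (f z * g z))\<^sup>2) \<le> norm (C\<^sup>2 * (norm (f z))\<^sup>2)"
      using assms(3)
    proof eventually_elim
      case (elim z)
      then have "(norm (g z))\<^sup>2 \<le> C\<^sup>2"
        by (intro power_mono) auto
      then show ?case
        by (simp add: norm_mult power_mult_distrib mult.commute[of "C\<^sup>2"] mult_left_mono)
    qed
  qed measurable
  then show ?thesis by (simp add: square_integrable_def)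
qed

lemma square_integrable_const_mult:
  "square_integrable f \<Longrightarrow> square_integrable (\<lambda>z. c * f z)"
  using square_integrable_bounded_mult[of f "\<lambda>_. c" "norm c"] by (simp add: mult.commute)

lemma integrable_mult_cnj:
  assumes "square_integrable f" "square_integrable g"
  shows "integrable circle (\<lambda>z. f z * cnj (g z))"
proof (rule Bochner_Integration.integrable_bound)
  have [measurable]: "f \<in> borel_measurable circle" "g \<in> borel_measurable circle"
    using assms by (auto simp: square_integrable_def)
  show "(\<lambda>z. f z * cnj (g z)) \<in> borel_measurable circle"
    by measurable
  show "integrable circle (\<lambda>z. (norm (f z))\<^sup>2 + (norm (g z))\<^sup>2)"
    using assms by (auto simp: square_integrable_def)
  have "norm (f z) * norm (g z) \<le> (norm (f z))\<^sup>2 + (norm (g z))\<^sup>2" for z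
    using sum_squares_bound[of "norm (f z)" "norm (g z)"]
      mult_nonneg_nonneg[OF norm_ge_zero[of "f z"] norm_ge_zero[of "g z"]] by linarith
  then show "AE z in circle. norm (f z * cnj (g z)) \<le> norm ((norm (f z))\<^sup>2 + (norm (g z))\<^sup>2)"
    by (auto simp: norm_mult)
qed

lemma square_integrable_imp_integrable:
  assumes "square_integrable f" shows "integrable circle f"
proof -
  interpret finite_measure circle by (rule finite_measure_circle)
  have "square_integrable (\<lambda>_. 1)"
    by (simp add: square_integrable_def)
  from integrable_mult_cnj[OF assms this] show ?thesis by simp
qed

lemma square_integrable_continuous:
  fixes g :: "complex \<Rightarrow> complex"
  assumes "continuous_on UNIV g" shows "square_integrable g"
    and "square_integrable f \<Longrightarrow> square_integrable (\<lambda>z. f z * g z)"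
proof -
  interpret finite_measure circle by (rule finite_measure_circle)
  have g: "g \<in> borel_measurable borel"
    using assms by (rule borel_measurable_continuous_onI)
  have "compact (g ` sphere 0 1)"
    by (intro compact_continuous_image continuous_on_subset[OF assms]) auto
  then obtain C where C: "\<And>z. norm z = 1 \<Longrightarrow> norm (g z) \<le> C"
    by (metis bounded_iff compact_imp_bounded image_eqI mem_sphere_0)
  have AE: "AE z in circle. norm (g z) \<le> C"
    using AE_circle_norm by eventually_elim (rule C)
  show "square_integrable f \<Longrightarrow> square_integrable (\<lambda>z. f z * g z)"
    by (rule square_integrable_bounded_mult[OF _ g AE])
  have "square_integrable (\<lambda>_. 1)"
    by (simp add: square_integrable_def)
  from square_integrable_bounded_mult[OF this g AE] show "square_integrable g" by simp
qed

lift_definition scaleC :: "complex \<Rightarrow> l2 \<Rightarrow> l2" is "\<lambda>c f z. c * f z"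
  by (auto simp: l2_rel_def square_integrable_const_mult)

lift_definition cinner :: "l2 \<Rightarrow> l2 \<Rightarrow> complex" is "\<lambda>f g. \<integral>z. f z * cnj (g z) \<partial>circle"
proof -
  fix f f' g g' assume "l2_rel f f'" "l2_rel g g'"
  then have [measurable]: "f \<in> borel_measurable circle" "f' \<in> borel_measurable circle"
      "g \<in> borel_measurable circle" "g' \<in> borel_measurable circle"
    and "AE z in circle. f z = f' z" "AE z in circle. g z = g' z"
    by (auto simp: l2_rel_def square_integrable_def)
  from this(5,6) show "(\<integral>z. f z * cnj (g z) \<partial>circle) = (\<integral>z. f' z * cnj (g' z) \<partial>circle)"
    by (intro integral_cong_AE) auto
qed

instantiation l2 :: real_vector
begin

lift_definition zero_l2 :: l2 is "\<lambda>_. 0"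
  by (simp add: l2_rel_def square_integrable_def)

lift_definition plus_l2 :: "l2 \<Rightarrow> l2 \<Rightarrow> l2" is "\<lambda>f g z. f z + g z"
  by (auto simp: l2_rel_def square_integrable_add)

lift_definition uminus_l2 :: "l2 \<Rightarrow> l2" is "\<lambda>f z. - f z"
  by (auto simp: l2_rel_def square_integrable_def)

definition minus_l2 :: "l2 \<Rightarrow> l2 \<Rightarrow> l2" where
  "minus_l2 f g = f + - g"

definition scaleR_l2 :: "real \<Rightarrow> l2 \<Rightarrow> l2" where
  "scaleR_l2 r f = scaleC (complex_of_real r) f"

instance
proof
  fix f g h :: l2 and a b :: real
  show "f + g + h = f + (g + h)"
    by transfer (auto simp: l2_rel_def square_integrable_add add.assoc)
  show "f + g = g + f"
    by transfer (auto simp: l2_rel_def square_integrable_add add.commute)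
  show "0 + f = f"
    by transfer (auto simp: l2_rel_def)
  show "- f + f = 0"
    by transfer (auto simp: l2_rel_def square_integrable_def)
  show "f - g = f + - g"
    by (rule minus_l2_def)
  show "a *\<^sub>R (f + g) = a *\<^sub>R f + a *\<^sub>R g"
    unfolding scaleR_l2_def
    by transfer (auto simp: l2_rel_def square_integrable_add square_integrable_const_mult distrib_left)
  show "(a + b) *\<^sub>R f = a *\<^sub>R f + b *\<^sub>R f"
    unfolding scaleR_l2_def of_real_add
    by transfer (auto simp: l2_rel_def square_integrable_add square_integrable_const_mult distrib_right)
  show "a *\<^sub>R b *\<^sub>R f = (a * b) *\<^sub>R f"
    unfolding scaleR_l2_def of_real_mult
    by transfer (auto simp: l2_rel_def square_integrable_const_mult mult.assoc)
  show "1 *\<^sub>R f = f"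
    unfolding scaleR_l2_def of_real_1
    by transfer (auto simp: l2_rel_def)
qed

end

global_interpretation l2: vector_space scaleC
  defines cspan = l2.span
proof
  fix a b :: complex and f g :: l2
  show "scaleC a (f + g) = scaleC a f + scaleC a g"
    by transfer (auto simp: l2_rel_def square_integrable_add square_integrable_const_mult distrib_left)
  show "scaleC (a + b) f = scaleC a f + scaleC b f"
    by transfer (auto simp: l2_rel_def square_integrable_add square_integrable_const_mult distrib_right)
  show "scaleC a (scaleC b f) = scaleC (a * b) f"
    by transfer (auto simp: l2_rel_def square_integrable_const_mult mult.assoc)
  show "scaleC 1 f = f"
    by transfer (auto simp: l2_rel_def)
qed

lemma cinner_add_left: "cinner (f + g) h = cinner f h + cinner g h"
  by transfer (simp add: l2_rel_def distrib_right integrable_mult_cnj)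

lemma cinner_scaleC_left: "cinner (scaleC c f) g = c * cinner f g"
  by transfer (simp add: mult.assoc)

lemma cinner_commute: "cinner f g = cnj (cinner g f)"
proof transfer
  fix f g
  have "(\<integral>z. f z * cnj (g z) \<partial>circle) = (\<integral>z. cnj (g z * cnj (f z)) \<partial>circle)"
    by (simp add: mult.commute)
  then show "(\<integral>z. f z * cnj (g z) \<partial>circle) = cnj (\<integral>z. g z * cnj (f z) \<partial>circle)"
    by (simp only: Bochner_Integration.integral_cnj)
qed

lemma cinner_self_nonneg: "0 \<le> Re (cinner f f)"
  and cinner_self_eq_0: "Re (cinner f f) = 0 \<longleftrightarrow> f = 0"
proof -
  have *: "Re (\<integral>z. f z * cnj (f z) \<partial>circle) = (\<integral>z. (norm (f z))\<^sup>2 \<partial>circle)" for f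
    by (simp only: complex_norm_square[symmetric] integral_complex_of_real Re_complex_of_real)
  show "0 \<le> Re (cinner f f)"
    by transfer (simp only: *, simp)
  show "Re (cinner f f) = 0 \<longleftrightarrow> f = 0"
  proof transfer
    fix f assume "l2_rel f f"
    then show "Re (\<integral>z. f z * cnj (f z) \<partial>circle) = 0 \<longleftrightarrow> l2_rel f (\<lambda>_. 0)"
      unfolding * by (subst integral_nonneg_eq_0_iff_AE) (auto simp: l2_rel_def square_integrable_def)
  qed
qed

instantiation l2 :: real_inner
begin

definition inner_l2 :: "l2 \<Rightarrow> l2 \<Rightarrow> real" where
  "inner_l2 f g = Re (cinner f g)"

definition norm_l2 :: "l2 \<Rightarrow> real" where
  "norm_l2 f = sqrt (Re (cinner f f))"

definition dist_l2 :: "l2 \<Rightarrow> l2 \<Rightarrow> real" where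
  "dist_l2 f g = norm (f - g)"

definition sgn_l2 :: "l2 \<Rightarrow> l2" where
  "sgn_l2 f = f /\<^sub>R norm f"

definition uniformity_l2 :: "(l2 \<times> l2) filter" where
  "uniformity_l2 = (INF e\<in>{0<..}. principal {(f, g). dist f g < e})"

definition open_l2 :: "l2 set \<Rightarrow> bool" where
  "open_l2 U \<longleftrightarrow> (\<forall>f\<in>U. \<forall>\<^sub>F (f', g) in uniformity. f' = f \<longrightarrow> g \<in> U)"

instance
proof
  fix f g h :: l2 and r :: real
  show "sgn f = f /\<^sub>R norm f"
    by (rule sgn_l2_def)
  show "dist f g = norm (f - g)"
    by (rule dist_l2_def)
  show "uniformity = (INF e\<in>{0<..}. principal {(f :: l2, g). dist f g < e})"
    by (rule uniformity_l2_def)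
  show "open U \<longleftrightarrow> (\<forall>f\<in>U. \<forall>\<^sub>F (f', g) in uniformity. f' = f \<longrightarrow> g \<in> U)" for U :: "l2 set"
    by (rule open_l2_def)
  show "f \<bullet> g = g \<bullet> f"
    unfolding inner_l2_def by (subst cinner_commute) simp
  show "(f + g) \<bullet> h = f \<bullet> h + g \<bullet> h"
    by (simp add: inner_l2_def cinner_add_left)
  show "r *\<^sub>R f \<bullet> g = r * (f \<bullet> g)"
    by (simp add: inner_l2_def scaleR_l2_def cinner_scaleC_left)
  show "0 \<le> f \<bullet> f"
    by (simp add: inner_l2_def cinner_self_nonneg)
  show "f \<bullet> f = 0 \<longleftrightarrow> f = 0"
    by (simp add: inner_l2_def cinner_self_eq_0)
  show "norm f = sqrt (f \<bullet> f)"
    by (simp add: norm_l2_def inner_l2_def)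
qed

end

lift_definition monomial :: "int \<Rightarrow> l2" is "\<lambda>n z. z powi n"
proof -
  fix n :: int
  interpret finite_measure circle by (rule finite_measure_circle)
  have "integrable circle (\<lambda>z. (norm (z powi n))\<^sup>2) \<longleftrightarrow> integrable circle (\<lambda>z. 1 :: real)"
  proof (rule integrable_cong_AE)
    show "AE z in circle. (norm (z powi n))\<^sup>2 = (1 :: real)"
      using AE_circle_norm by eventually_elim (simp add: norm_power_int)
  qed (simp_all add: power_int_def)
  then show "l2_rel (\<lambda>z. z powi n) (\<lambda>z. z powi n)"
    by (simp add: l2_rel_def square_integrable_def power_int_def)
qed

definition hardy :: "l2 set" where
  "hardy = {f. \<forall>n<0. cinner f (monomial n) = 0}"

definition riesz_proj :: "l2 \<Rightarrow> l2" where
  "riesz_proj f = (THE h. h \<in> hardy \<and> (\<forall>g\<in>hardy. cinner (f - h) g = 0))"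

lift_definition shift :: "l2 \<Rightarrow> l2" is "\<lambda>f z. z * f z"
proof -
  fix f g assume "l2_rel f g"
  moreover have "square_integrable (\<lambda>z. z * h z)" if "square_integrable h" for h
    using square_integrable_continuous(2)[OF continuous_on_id that] by (simp add: mult.commute)
  ultimately show "l2_rel (\<lambda>z. z * f z) (\<lambda>z. z * g z)"
    by (auto simp: l2_rel_def)
qed

text \<open>The adjoint is taken in the Hardy space, not in all of \<open>L\<^sup>2\<close>, where the shift is unitary.\<close>

definition shift_adj :: "l2 \<Rightarrow> l2" where
  "shift_adj g = (THE h. h \<in> hardy \<and> (\<forall>f\<in>hardy. cinner (shift f) g = cinner f h))"

definition arc :: "real \<Rightarrow> real \<Rightarrow> complex set" where
  "arc a b = cis ` {a..b}"

definition arc_average :: "real \<Rightarrow> real \<Rightarrow> (complex \<Rightarrow> 'a) \<Rightarrow> 'a::{banach, second_countable_topology}" where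
  "arc_average a b f = (LINT z:arc a b|circle. f z) /\<^sub>R measure circle (arc a b)"

lemma arc_average_cong:
  assumes "f \<in> borel_measurable circle" "g \<in> borel_measurable circle" "AE z in circle. f z = g z"
  shows "arc_average a b f = arc_average a b g"
proof -
  have "compact (arc a b)"
    unfolding arc_def by (intro compact_continuous_image continuous_intros) auto
  then have [measurable]: "arc a b \<in> sets borel"
    by (intro borel_closed compact_imp_closed)
  note [measurable] = assms(1,2)
  show ?thesis
    unfolding arc_average_def set_lebesgue_integral_def
    using assms(3) by (intro arg_cong[where f = "\<lambda>x. x /\<^sub>R _"] integral_cong_AE) auto
qed

lift_definition bmo :: "l2 \<Rightarrow> bool" is
  "\<lambda>f. \<exists>C. \<forall>a b. a < b \<and> b \<le> a + 2*pi \<longrightarrow>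
     arc_average a b (\<lambda>z. norm (f z - arc_average a b f)) \<le> C"
proof -
  fix f g assume fg: "l2_rel f g"
  have [measurable]: "f \<in> borel_measurable circle" "g \<in> borel_measurable circle"
    and AE: "AE z in circle. f z = g z"
    using fg by (auto simp: l2_rel_def square_integrable_def)
  have eq: "arc_average a b f = arc_average a b g" for a b
    by (rule arc_average_cong[OF _ _ AE]) measurable
  have "arc_average a b (\<lambda>z. norm (f z - arc_average a b f)) =
      arc_average a b (\<lambda>z. norm (g z - arc_average a b g))" for a b
    unfolding eq by (rule arc_average_cong) (use AE in auto)
  then show "(\<exists>C. \<forall>a b. a < b \<and> b \<le> a + 2*pi \<longrightarrow>
        arc_average a b (\<lambda>z. norm (f z - arc_average a b f)) \<le> C) \<longleftrightarrow>
      (\<exists>C. \<forall>a b. a < b \<and> b \<le> a + 2*pi \<longrightarrow>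
        arc_average a b (\<lambda>z. norm (g z - arc_average a b g)) \<le> C)"
    by simp
qed

definition BMOA :: "l2 set" where
  "BMOA = {u \<in> hardy. bmo u}"

lift_definition poly_l2 :: "complex poly \<Rightarrow> l2" is "\<lambda>p z. poly p z"
  by (simp add: l2_rel_def square_integrable_continuous(1) continuous_intros)

lift_definition times_cnj_poly :: "l2 \<Rightarrow> complex poly \<Rightarrow> l2" is "\<lambda>u p z. u z * cnj (poly p z)"
proof -
  fix u v :: "complex \<Rightarrow> complex" and p :: "complex poly"
  assume "l2_rel u v"
  moreover have "continuous_on UNIV (\<lambda>z. cnj (poly p z))"
    by (intro continuous_intros)
  ultimately show "l2_rel (\<lambda>z. u z * cnj (poly p z)) (\<lambda>z. v z * cnj (poly p z))"
    by (auto simp: l2_rel_def intro: square_integrable_continuous(2))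
qed

definition hankel_poly_graph :: "l2 \<Rightarrow> (l2 \<times> l2) set" where
  "hankel_poly_graph u = {(poly_l2 p, riesz_proj (times_cnj_poly u p)) | p. True}"

text \<open>
  Extension of the Hankel operator from polynomials to the Hardy space by taking limits:
  \<open>hankel u f = g\<close> if there are polynomials \<open>p\<^sub>k\<close> with \<open>p\<^sub>k \<longlonglongrightarrow> f\<close> whose images tend to \<open>g\<close>.
  For \<open>u\<close> in \<open>hardy\<close> the closure of the graph on polynomials is single valued, and for \<open>u\<close> in
  \<open>BMOA\<close> that operator is bounded, so \<open>hankel u\<close> is its continuous extension and the value
  \<open>0\<close> is not used on \<open>hardy\<close>.
\<close>

definition hankel :: "l2 \<Rightarrow> l2 \<Rightarrow> l2" where
  "hankel u f =
     (if \<exists>g. (f, g) \<in> closure (hankel_poly_graph u)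
      then THE g. (f, g) \<in> closure (hankel_poly_graph u) else 0)"

definition hankel_shifted :: "l2 \<Rightarrow> l2 \<Rightarrow> l2" where
  "hankel_shifted u = shift_adj \<circ> hankel u"

definition hankel_range :: "l2 \<Rightarrow> l2 set" where
  "hankel_range u = closure (hankel u ` hardy)"

definition hankel_ess :: "l2 \<Rightarrow> l2 \<Rightarrow> l2" where
  "hankel_ess u = restrict (hankel u) (hankel_range u)"

definition hankel_shifted_ess :: "l2 \<Rightarrow> l2 \<Rightarrow> l2" where
  "hankel_shifted_ess u = restrict (hankel_shifted u) (hankel_range u)"

definition bounded_selfadjoint_on :: "l2 set \<Rightarrow> (l2 \<Rightarrow> l2) \<Rightarrow> bool" where
  "bounded_selfadjoint_on X A \<longleftrightarrow>
     A ` X \<subseteq> X \<and>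
     (\<forall>f\<in>X. \<forall>g\<in>X. A (f + g) = A f + A g) \<and>
     (\<forall>c. \<forall>f\<in>X. A (scaleC c f) = scaleC c (A f)) \<and>
     (\<exists>C. \<forall>f\<in>X. norm (A f) \<le> C * norm f) \<and>
     (\<forall>f\<in>X. \<forall>g\<in>X. cinner (A f) g = cinner f (A g))"

definition cyclic_subspace :: "(l2 \<Rightarrow> l2) \<Rightarrow> l2 \<Rightarrow> l2 set" where
  "cyclic_subspace A v = closure (cspan (range (\<lambda>n. (A ^^ n) v)))"

definition cyclic_vector :: "l2 set \<Rightarrow> (l2 \<Rightarrow> l2) \<Rightarrow> l2 \<Rightarrow> bool" where
  "cyclic_vector X A v \<longleftrightarrow> v \<in> X \<and> cyclic_subspace A v = X"

text \<open>Simplicity of the spectrum is a property of bounded self-adjoint operators on \<open>X\<close>, which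
  the first conjunct records; for \<open>u\<close> in \<open>BMOA\<close> the operators below always satisfy it.\<close>

definition simple_spectrum :: "l2 set \<Rightarrow> (l2 \<Rightarrow> l2) \<Rightarrow> bool" where
  "simple_spectrum X A \<longleftrightarrow> bounded_selfadjoint_on X A \<and> (\<exists>v. cyclic_vector X A v)"

definition BMOA_simp :: "l2 set" where
  "BMOA_simp = {u \<in> BMOA.
     simple_spectrum (hankel_range u) (hankel_ess u ^^ 2) \<and>
     simple_spectrum (hankel_range u) (hankel_shifted_ess u ^^ 2)}"

end

(*
  Write H = H_u and G = S^* H. On the closed range X of H one has G^2 = H^2 - <., u> u, so u
  generates the same closed subspace M under H^2 and under G^2. If H^2 has a cyclic vector v and P is
  the projection onto an H^2-invariant M, then the form <H (1 - P) f, P g> is symmetric on the vectors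
  H^{2n} v, hence on X, and this forces H M to lie in M; likewise for G. Since H is injective and
  symmetric on X, H M is dense in M, and S^* H = G then gives S^* M in M. Thus M contains all
  S^{*n} u = H z^n, that is, M = X.

  No boundedness theorem for BMOA symbols enters: H is the closure of its restriction to polynomials.
  If X lies in the domain of this closure, ||H f||^2 = <H^2 f, f> gives a bound on X from the
  boundedness of H^2 there. Otherwise the square of H extended by 0 vanishes on X by linearity, so X,
  having a cyclic vector for 0, is spanned by u.
*)

theory Submission
  imports Defs
begin

section \<open>Hilbert space structure of the space of square integrable functions\<close>

text \<open>Antilinearity is the obstacle. A subspace invariant under H^2 need not be invariant
  under H: on C^2 the symmetric map (a, b) -> (cnj b, cnj a) has square 1, so every line is
  invariant under the square, but most lines are not invariant under the map. Such multiplicity is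
  what a cyclic vector excludes. The argument runs once for H and once for G, each time with the
  cyclic vector of its own square.

  The rank one term comes from S S^* = 1 - <., 1> 1, since H S = S^* H and <H f, 1> = <u, f>.

  The Riesz projection and S^* are definite descriptions, so nothing can be said about them before
  orthogonal projections exist, that is, before \<open>l2\<close> is known to be complete.
  Uniqueness of Fourier coefficients is the second analytic input: it gives the formula for S S^*
  and shows that the closure of H is single valued.\<close>

lemma orthogonal_projection_exists:
  fixes V :: "'a :: {real_inner, complete_space} set"
  assumes "subspace V" "closed V"
  shows "\<exists>h\<in>V. \<forall>g\<in>V. inner (f - h) g = 0"
proof -
  define D where "D = (INF g\<in>V. (norm (f - g))\<^sup>2)"
  have bdd: "bdd_below ((\<lambda>g. (norm (f - g))\<^sup>2) ` V)"
    by (rule bdd_belowI[of _ 0]) auto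
  have "V \<noteq> {}"
    using subspace_0[OF assms(1)] by auto
  have lower: "D \<le> (norm (f - g))\<^sup>2" if "g \<in> V" for g
    unfolding D_def using bdd that by (rule cINF_lower)
  have "\<exists>g\<in>V. (norm (f - g))\<^sup>2 < D + inverse (of_nat (Suc n))" for n
  proof -
    have "D < D + inverse (of_nat (Suc n))" by simp
    then show ?thesis
      using cINF_less_iff[OF \<open>V \<noteq> {}\<close> bdd] unfolding D_def by blast
  qed
  then obtain g where gV: "\<And>n. g n \<in> V"
    and g: "\<And>n. (norm (f - g n))\<^sup>2 < D + inverse (of_nat (Suc n))"
    by metis
  \<comment> \<open>The parallelogram law: the midpoint lies in \<open>V\<close>, so its squared
    distance to \<open>f\<close> is at least \<open>D\<close>, and two near-minimisers must be close
    to each other.\<close>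
  have diff: "(norm (g m - g n))\<^sup>2 \<le> 2 * inverse (of_nat (Suc m)) + 2 * inverse (of_nat (Suc n))" for m n
  proof -
    have mid: "(1/2) *\<^sub>R (g m + g n) \<in> V"
      using gV assms(1) by (simp add: subspace_add subspace_scale)
    have "(norm (g m - g n))\<^sup>2 =
        2 * (norm (f - g m))\<^sup>2 + 2 * (norm (f - g n))\<^sup>2 - 4 * (norm (f - (1/2) *\<^sub>R (g m + g n)))\<^sup>2"
      by (simp add: power2_norm_eq_inner algebra_simps inner_commute)
    then show ?thesis
      using lower[OF mid] g[of m] g[of n] by linarith
  qed
  have "Cauchy g"
  proof (rule metric_CauchyI)
    fix e :: real assume "0 < e"
    then obtain N where N: "inverse (of_nat (Suc N)) < e\<^sup>2 / 4"
      using reals_Archimedean[of "e\<^sup>2 / 4"] by auto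
    have "dist (g m) (g n) < e" if "m \<ge> N" "n \<ge> N" for m n
    proof -
      have "inverse (of_nat (Suc m)) \<le> (inverse (of_nat (Suc N)) :: real)"
        "inverse (of_nat (Suc n)) \<le> (inverse (of_nat (Suc N)) :: real)"
        using that by (simp_all add: le_imp_inverse_le)
      then have "(norm (g m - g n))\<^sup>2 < e\<^sup>2"
        using diff[of m n] N by linarith
      then show ?thesis
        using \<open>0 < e\<close> by (simp add: dist_norm power2_less_imp_less)
    qed
    then show "\<exists>M. \<forall>m\<ge>M. \<forall>n\<ge>M. dist (g m) (g n) < e" by blast
  qed
  then obtain h where h: "g \<longlonglongrightarrow> h"
    using Cauchy_convergent convergent_def by blast
  have hV: "h \<in> V"
    using closed_sequentially[OF assms(2)] gV h by blast
  have min: "(norm (f - h))\<^sup>2 \<le> D"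
  proof (rule LIMSEQ_le)
    show "(\<lambda>n. (norm (f - g n))\<^sup>2) \<longlonglongrightarrow> (norm (f - h))\<^sup>2"
      by (intro tendsto_intros h)
    show "(\<lambda>n. D + inverse (of_nat (Suc n))) \<longlonglongrightarrow> D"
      using tendsto_add[OF tendsto_const LIMSEQ_inverse_real_of_nat, of D] by simp
    show "\<exists>N. \<forall>n\<ge>N. (norm (f - g n))\<^sup>2 \<le> D + inverse (of_nat (Suc n))"
      using g less_imp_le by blast
  qed
  have "inner (f - h) k = 0" if "k \<in> V" for k
  proof (rule ccontr)
    assume *: "inner (f - h) k \<noteq> 0"
    then have k: "inner k k > 0"
      by auto
    \<comment> \<open>The minimiser of the quadratic
      \<open>(norm ((f - h) - t *\<^sub>R k))\<^sup>2\<close> in \<open>t\<close>; the minimum would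
      fall below \<open>D\<close> if \<open>inner (f - h) k\<close> were not 0.\<close>
    define t where "t = inner (f - h) k / inner k k"
    have "h + t *\<^sub>R k \<in> V"
      using hV that assms(1) by (simp add: subspace_add subspace_scale)
    then have "(norm (f - h))\<^sup>2 \<le> (norm ((f - h) - t *\<^sub>R k))\<^sup>2"
      unfolding diff_diff_eq using lower[of "h + t *\<^sub>R k"] min by linarith
    also have "\<dots> = (norm (f - h))\<^sup>2 - 2 * t * inner (f - h) k + t * t * inner k k"
      unfolding power2_norm_eq_inner
      by (simp add: inner_diff_left inner_diff_right inner_commute algebra_simps)
    also have "\<dots> = (norm (f - h))\<^sup>2 - (inner (f - h) k)\<^sup>2 / inner k k"
      using k by (simp add: t_def power2_eq_square)
    finally show False
      using * k by (simp add: divide_le_0_iff)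
  qed
  with hV show ?thesis by blast
qed

section \<open>Norms as integrals and completeness\<close>

lemma abs_l2_cases:
  obtains \<phi> where "square_integrable \<phi>" "f = abs_l2 \<phi>"
  using that by (induction f rule: l2.abs_induct) (auto simp: l2_rel_def)

lemma l2_rel_refl: "square_integrable \<phi> \<Longrightarrow> l2_rel \<phi> \<phi>"
  by (simp add: l2_rel_def)

lemma square_integrable_diff:
  "square_integrable f \<Longrightarrow> square_integrable g \<Longrightarrow> square_integrable (\<lambda>z. f z - g z)"
  using square_integrable_add[of f "\<lambda>z. -1 * g z"] square_integrable_const_mult[of g "-1"] by simp

lemma norm_diff_abs_l2:
  assumes "square_integrable \<phi>" "square_integrable \<psi>"
  shows "(norm (abs_l2 \<phi> - abs_l2 \<psi>))\<^sup>2 = (\<integral>z. (norm (\<phi> z - \<psi> z))\<^sup>2 \<partial>circle)"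
proof -
  have 1: "abs_l2 \<phi> - abs_l2 \<psi> = abs_l2 (\<lambda>z. \<phi> z - \<psi> z)"
    using assms square_integrable_const_mult[OF assms(2), of "-1"]
    by (simp add: minus_l2_def uminus_l2.abs_eq plus_l2.abs_eq l2_rel_refl)
  have 2: "Re (\<integral>z. f z * cnj (f z) \<partial>circle) = (\<integral>z. (norm (f z))\<^sup>2 \<partial>circle)" for f
    by (simp only: complex_norm_square[symmetric] integral_complex_of_real Re_complex_of_real)
  show ?thesis
    using assms 2[of "\<lambda>z. \<phi> z - \<psi> z"]
    by (simp add: 1 norm_l2_def cinner_self_nonneg cinner.abs_eq l2_rel_refl square_integrable_diff)
qed

text \<open>Nonnegativity of the variance of \<open>norm (\<phi> z)\<close>, the total mass of
  \<open>circle\<close> being 1. It makes an L2 Cauchy sequence L1 Cauchy, which yields a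
  subsequence converging almost everywhere.\<close>

lemma integral_norm_le_l2:
  assumes "square_integrable \<phi>"
  shows "(\<integral>z. norm (\<phi> z) \<partial>circle)\<^sup>2 \<le> (\<integral>z. (norm (\<phi> z))\<^sup>2 \<partial>circle)"
proof -
  interpret finite_measure circle by (rule finite_measure_circle)
  have m: "measure circle UNIV = 1"
    using prob_space_circle by (simp add: measure_def)
  define c where "c = (\<integral>z. norm (\<phi> z) \<partial>circle)"
  have i: "integrable circle (\<lambda>z. norm (\<phi> z))" "integrable circle (\<lambda>z. (norm (\<phi> z))\<^sup>2)"
    using assms Defs.square_integrable_imp_integrable[OF assms] by (auto simp: square_integrable_def)
  have "0 \<le> (\<integral>z. (norm (\<phi> z) - c)\<^sup>2 \<partial>circle)"
    by simp
  also have "\<dots> = (\<integral>z. (norm (\<phi> z))\<^sup>2 - 2 * c * norm (\<phi> z) + c\<^sup>2 \<partial>circle)"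
    by (simp add: power2_diff algebra_simps)
  also have "\<dots> = (\<integral>z. (norm (\<phi> z))\<^sup>2 \<partial>circle) - 2 * c * c + c\<^sup>2"
    using i by (simp add: m c_def)
  finally show ?thesis
    by (simp add: c_def power2_eq_square)
qed

text \<open>Fatou's lemma, meant for the differences between a fixed member of a Cauchy sequence and
  the members of a subsequence; the bound on these holds only eventually.\<close>

lemma square_integrable_fatou:
  assumes s: "\<And>n. square_integrable (s n)" and [measurable]: "t \<in> borel_measurable circle"
    and lim: "AE z in circle. (\<lambda>n. s n z) \<longlonglongrightarrow> t z"
    and bd: "\<forall>\<^sub>F n in sequentially. (\<integral>z. (norm (s n z))\<^sup>2 \<partial>circle) \<le> C"
  shows "square_integrable t" "(\<integral>z. (norm (t z))\<^sup>2 \<partial>circle) \<le> C"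
proof -
  have [measurable]: "s n \<in> borel_measurable circle" for n
    using s by (simp add: square_integrable_def)
  have "C \<ge> 0"
  proof -
    obtain n where "(\<integral>z. (norm (s n z))\<^sup>2 \<partial>circle) \<le> C"
      using bd eventually_sequentially by auto
    moreover have "0 \<le> (\<integral>z. (norm (s n z))\<^sup>2 \<partial>circle)" by simp
    ultimately show ?thesis by linarith
  qed
  have "(\<integral>\<^sup>+z. ennreal ((norm (t z))\<^sup>2) \<partial>circle)
      = (\<integral>\<^sup>+z. liminf (\<lambda>n. ennreal ((norm (s n z))\<^sup>2)) \<partial>circle)"
  proof (rule nn_integral_cong_AE)
    show "AE z in circle. ennreal ((norm (t z))\<^sup>2) = liminf (\<lambda>n. ennreal ((norm (s n z))\<^sup>2))"
      using lim
    proof eventually_elim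
      case (elim z)
      have "(\<lambda>n. ennreal ((norm (s n z))\<^sup>2)) \<longlonglongrightarrow> ennreal ((norm (t z))\<^sup>2)"
        by (intro tendsto_ennrealI tendsto_intros elim)
      from lim_imp_Liminf[OF _ this] show ?case
        by simp
    qed
  qed
  also have "\<dots> \<le> liminf (\<lambda>n. \<integral>\<^sup>+z. ennreal ((norm (s n z))\<^sup>2) \<partial>circle)"
    by (rule nn_integral_liminf) measurable
  also have "\<dots> \<le> ennreal C"
  proof -
    have "(\<integral>\<^sup>+z. ennreal ((norm (s n z))\<^sup>2) \<partial>circle) = ennreal (\<integral>z. (norm (s n z))\<^sup>2 \<partial>circle)" for n
      using s by (intro nn_integral_eq_integral) (auto simp: square_integrable_def)
    then have "\<forall>\<^sub>F n in sequentially. (\<integral>\<^sup>+z. ennreal ((norm (s n z))\<^sup>2) \<partial>circle) \<le> ennreal C"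
      using bd by (auto intro: ennreal_leI elim: eventually_mono)
    then have "liminf (\<lambda>n. \<integral>\<^sup>+z. ennreal ((norm (s n z))\<^sup>2) \<partial>circle) \<le> liminf (\<lambda>n. ennreal C)"
      by (rule Liminf_mono)
    then show ?thesis
      by (simp add: Liminf_const)
  qed
  finally have le: "(\<integral>\<^sup>+z. ennreal ((norm (t z))\<^sup>2) \<partial>circle) \<le> ennreal C" .
  then have "integrable circle (\<lambda>z. (norm (t z))\<^sup>2)"
    by (intro integrableI_bounded) (auto simp: le_less_trans)
  then show "square_integrable t"
    by (simp add: square_integrable_def)
  show "(\<integral>z. (norm (t z))\<^sup>2 \<partial>circle) \<le> C"
    using le \<open>C \<ge> 0\<close> by (simp add: integral_eq_nn_integral enn2real_leI)
qed

text \<open>The Riesz-Fischer theorem: an almost everywhere convergent subsequence supplies the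
  candidate \<open>t\<close>, and Fatou for \<open>\<phi> n - \<phi> (r i)\<close> as
  \<open>i\<close> grows bounds the distance from \<open>X n\<close> to it along the whole sequence,
  not only along the subsequence.\<close>

instance l2 :: complete_space
proof
  fix X :: "nat \<Rightarrow> l2"
  assume X: "Cauchy X"
  have "\<exists>\<phi>. square_integrable \<phi> \<and> X n = abs_l2 \<phi>" for n
    by (metis abs_l2_cases)
  then obtain \<phi> where \<phi>: "\<And>n. square_integrable (\<phi> n)" "\<And>n. X n = abs_l2 (\<phi> n)"
    by metis
  have [measurable]: "\<phi> n \<in> borel_measurable circle" for n
    using \<phi> by (simp add: square_integrable_def)
  have dist: "(dist (X m) (X n))\<^sup>2 = (\<integral>z. (norm (\<phi> m z - \<phi> n z))\<^sup>2 \<partial>circle)" for m n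
    by (simp add: dist_norm \<phi> norm_diff_abs_l2)
  have dist1: "(\<integral>z. norm (\<phi> m z - \<phi> n z) \<partial>circle) \<le> dist (X m) (X n)" for m n
    using integral_norm_le_l2[OF square_integrable_diff[OF \<phi>(1)[of m] \<phi>(1)[of n]], folded dist]
    by (rule power2_le_imp_le) (rule zero_le_dist)
  obtain r where r: "strict_mono r" and AE: "AE z in circle. Cauchy (\<lambda>i. \<phi> (r i) z)"
  proof (rule cauchy_L1_AE_cauchy_subseq[of circle \<phi>])
    show "\<exists>N. \<forall>i\<ge>N. \<forall>j\<ge>N. (LINT z|circle. norm (\<phi> i z - \<phi> j z)) < e" if "e > 0" for e
    proof -
      obtain N where "\<forall>i\<ge>N. \<forall>j\<ge>N. dist (X i) (X j) < e"
        using metric_CauchyD[OF X \<open>e > 0\<close>] by auto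
      with dist1 show ?thesis
        by (blast intro: le_less_trans)
    qed
  qed (rule square_integrable_imp_integrable[OF \<phi>(1)])
  define t where "t z = lim (\<lambda>i. \<phi> (r i) z)" for z
  have [measurable]: "t \<in> borel_measurable circle"
    unfolding t_def by measurable
  have lim: "AE z in circle. (\<lambda>i. \<phi> (r i) z) \<longlonglongrightarrow> t z"
    using AE
  proof eventually_elim
    case (elim z)
    from Cauchy_convergent[OF this] show ?case
      unfolding t_def convergent_LIMSEQ_iff .
  qed
  have main: "square_integrable (\<lambda>z. \<phi> n z - t z) \<and> (\<integral>z. (norm (\<phi> n z - t z))\<^sup>2 \<partial>circle) \<le> e\<^sup>2"
    if N: "\<And>i j. i \<ge> N \<Longrightarrow> j \<ge> N \<Longrightarrow> dist (X i) (X j) < e" and n: "n \<ge> N" for n N e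
  proof -
    have 1: "square_integrable (\<lambda>z. \<phi> n z - \<phi> (r i) z)" for i
      by (intro square_integrable_diff \<phi>)
    have 2: "AE z in circle. (\<lambda>i. \<phi> n z - \<phi> (r i) z) \<longlonglongrightarrow> \<phi> n z - t z"
      using lim by eventually_elim (intro tendsto_intros)
    have 3: "\<forall>\<^sub>F i in sequentially. (\<integral>z. (norm (\<phi> n z - \<phi> (r i) z))\<^sup>2 \<partial>circle) \<le> e\<^sup>2"
    proof (rule eventually_sequentiallyI[of N])
      fix i assume "i \<ge> N"
      then have "r i \<ge> N"
        using seq_suble[OF r, of i] by linarith
      then have "dist (X n) (X (r i)) < e"
        by (rule N[OF n])
      then have "(dist (X n) (X (r i)))\<^sup>2 \<le> e\<^sup>2"
        by (intro power_mono) auto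
      then show "(\<integral>z. (norm (\<phi> n z - \<phi> (r i) z))\<^sup>2 \<partial>circle) \<le> e\<^sup>2"
        unfolding dist .
    qed
    have "(\<lambda>z. \<phi> n z - t z) \<in> borel_measurable circle"
      by measurable
    from square_integrable_fatou[OF 1 this 2 3] show ?thesis by (rule conjI)
  qed
  have t: "square_integrable t"
  proof -
    obtain N where "\<forall>i\<ge>N. \<forall>j\<ge>N. dist (X i) (X j) < 1"
      using metric_CauchyD[OF X, of 1] by auto
    then have "i \<ge> N \<Longrightarrow> j \<ge> N \<Longrightarrow> dist (X i) (X j) < 1" for i j
      by blast
    from main[OF this order_refl] have "square_integrable (\<lambda>z. \<phi> N z - t z)" by (rule conjunct1)
    from square_integrable_diff[OF \<phi>(1)[of N] this] show ?thesis by simp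
  qed
  have "X \<longlonglongrightarrow> abs_l2 t"
  proof (rule metric_LIMSEQ_I)
    fix e :: real assume e: "e > 0"
    then obtain N where "\<forall>i\<ge>N. \<forall>j\<ge>N. dist (X i) (X j) < e / 2"
      using metric_CauchyD[OF X, of "e / 2"] by auto
    then have N: "i \<ge> N \<Longrightarrow> j \<ge> N \<Longrightarrow> dist (X i) (X j) < e / 2" for i j
      by blast
    have "dist (X n) (abs_l2 t) < e" if "n \<ge> N" for n
    proof -
      have "(dist (X n) (abs_l2 t))\<^sup>2 = (\<integral>z. (norm (\<phi> n z - t z))\<^sup>2 \<partial>circle)"
        unfolding dist_norm \<phi>(2) by (rule norm_diff_abs_l2[OF \<phi>(1) t])
      also have "\<dots> \<le> (e / 2)\<^sup>2"
        using main[OF N that] by (rule conjunct2)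
      finally have "dist (X n) (abs_l2 t) \<le> e / 2"
        by (rule power2_le_imp_le) (use e in simp)
      also have "\<dots> < e" using e by simp
      finally show ?thesis .
    qed
    then show "\<exists>N. \<forall>n\<ge>N. dist (X n) (abs_l2 t) < e" by (intro exI[of _ N]) simp
  qed
  then show "convergent X"
    by (rule convergentI)
qed

section \<open>Completeness of the trigonometric system\<close>

lemma integral_circle:
  fixes f :: "complex \<Rightarrow> complex"
  assumes [measurable]: "f \<in> borel_measurable borel"
  shows "integral\<^sup>L circle f = (\<integral>t. indicator {0..2*pi} t *\<^sub>R f (cis t) \<partial>lborel) /\<^sub>R (2 * pi)"
proof -
  have d: "uniform_measure lborel {0..2*pi} = density lborel (\<lambda>t. ennreal (indicator {0..2*pi} t / (2*pi)))"
    unfolding uniform_measure_def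
    by (intro arg_cong2[where f = density] ext) (auto simp: divide_ennreal[of 1 "2*pi", simplified] indicator_def)
  have "integral\<^sup>L circle f = (\<integral>t. f (cis t) \<partial>uniform_measure lborel {0..2*pi})"
    unfolding circle_def by (rule integral_distr) measurable
  also have "\<dots> = (\<integral>t. (indicator {0..2*pi} t / (2*pi)) *\<^sub>R f (cis t) \<partial>lborel)"
    unfolding d by (rule integral_density) auto
  also have "\<dots> = (\<integral>t. (1 / (2*pi)) *\<^sub>R (indicator {0..2*pi} t *\<^sub>R f (cis t)) \<partial>lborel)"
    by simp
  also have "\<dots> = (1 / (2*pi)) *\<^sub>R (\<integral>t. indicator {0..2*pi} t *\<^sub>R f (cis t) \<partial>lborel)"
    by (rule integral_scaleR_right)
  finally show ?thesis
    by (simp add: inverse_eq_divide)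
qed

text \<open>For nonzero \<open>n\<close> the function \<open>cis t powi n\<close> has an
  antiderivative of period 2 pi, namely itself divided by \<open>\<i> n\<close>.\<close>

lemma integral_circle_power_int:
  assumes "n \<noteq> (0 :: int)"
  shows "(\<integral>z. z powi n \<partial>circle) = 0"
proof -
  have m: "(\<lambda>z :: complex. z powi n) \<in> borel_measurable borel"
    by (simp add: power_int_def)
  have e: "cis t powi n = exp (\<i> * of_int n * of_real t)" for t
    by (simp add: cis_conv_exp exp_power_int mult_ac)
  have "(\<integral>t. indicator {0..2*pi} t *\<^sub>R (cis t powi n) \<partial>lborel)
      = exp (\<i> * of_int n * of_real (2*pi)) / (\<i> * of_int n) - exp (\<i> * of_int n * of_real 0) / (\<i> * of_int n)"
    unfolding e
  proof (rule integral_FTC_atLeastAtMost)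
    show "((\<lambda>t. exp (\<i> * of_int n * of_real t) / (\<i> * of_int n)) has_vector_derivative
        exp (\<i> * of_int n * of_real t)) (at t within {0..2*pi})" for t
    proof (rule has_vector_derivative_real_field)
      show "((\<lambda>z. exp (\<i> * of_int n * z) / (\<i> * of_int n)) has_field_derivative
          exp (\<i> * of_int n * of_real t)) (at (of_real t))"
        using assms by (auto intro!: derivative_eq_intros)
    qed
  qed (auto intro!: continuous_intros)
  also have "exp (\<i> * of_int n * of_real (2*pi)) = 1"
    using exp_integer_2pi[of "of_int n"] by (simp add: mult_ac)
  finally show ?thesis
    by (simp add: integral_circle[OF m])
qed

lemma cnj_power_int_circle:
  "norm (z :: complex) = 1 \<Longrightarrow> cnj (z powi n) = z powi (- n)"
proof -
  assume "norm z = 1"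
  then have "z * cnj z = 1"
    by (simp add: complex_norm_square[symmetric])
  then have "cnj z = inverse z"
    using inverse_unique by metis
  then show ?thesis
    by (simp add: power_int_def power_inverse)
qed

lemma cinner_monomial: "cinner (monomial m) (monomial n) = (if m = n then 1 else 0)"
proof transfer
  fix m n :: int
  have "(\<integral>z. z powi m * cnj (z powi n) \<partial>circle) = (\<integral>z. z powi (m - n) \<partial>circle)"
  proof (rule integral_cong_AE)
    show "AE z in circle. z powi m * cnj (z powi n) = z powi (m - n)"
      using AE_circle_norm
    proof eventually_elim
      case (elim z)
      then have "z \<noteq> 0" by auto
      with elim show ?case
        by (simp only: cnj_power_int_circle power_int_add[symmetric] simp_thms) simp
    qed
  qed (simp_all add: power_int_def)
  then show "(\<integral>z. z powi m * cnj (z powi n) \<partial>circle) = (if m = n then 1 else 0)"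
    using integral_circle_power_int[of "m - n"] prob_space_circle by (simp add: measure_def)
qed

text \<open>The functions with vanishing Fourier coefficients form a module over the real polynomials in
  \<open>Re z\<close> and \<open>Im z\<close>, because multiplication by \<open>z\<close> and \<open>1/z\<close> shifts the coefficients.\<close>

definition fourier_null :: "(complex \<Rightarrow> complex) \<Rightarrow> bool" where
  "fourier_null f \<longleftrightarrow> integrable circle f \<and> (\<forall>n. (\<integral>z. f z * z powi n \<partial>circle) = 0)"

lemma measurable_power_int [measurable]: "(\<lambda>z :: complex. z powi n) \<in> borel_measurable borel"
  by (simp add: power_int_def)

lemma integrable_mult_power_int:
  assumes "integrable circle f"
  shows "integrable circle (\<lambda>z. f z * z powi n)"
proof (rule Bochner_Integration.integrable_bound[OF assms])
  have [measurable]: "f \<in> borel_measurable circle"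
    using assms by auto
  show "(\<lambda>z. f z * z powi n) \<in> borel_measurable circle"
    by measurable
  show "AE z in circle. norm (f z * z powi n) \<le> norm (f z)"
    using AE_circle_norm by eventually_elim (simp add: norm_mult norm_power_int)
qed

lemma fourier_null_mult_const: "fourier_null f \<Longrightarrow> fourier_null (\<lambda>z. c * f z)"
  by (simp add: fourier_null_def mult.assoc)

lemma fourier_null_add:
  "fourier_null f \<Longrightarrow> fourier_null g \<Longrightarrow> fourier_null (\<lambda>z. f z + g z)"
  by (simp add: fourier_null_def distrib_right integrable_mult_power_int)

lemma fourier_null_cong_AE:
  assumes "fourier_null f" "AE z in circle. f z = g z" "g \<in> borel_measurable circle"
  shows "fourier_null g"
proof -
  have [measurable]: "f \<in> borel_measurable circle" "g \<in> borel_measurable circle"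
    using assms by (auto simp: fourier_null_def)
  have "integrable circle g"
    using assms(1,2) integrable_cong_AE[of f circle g] by (auto simp: fourier_null_def)
  moreover have "(\<integral>z. g z * z powi n \<partial>circle) = (\<integral>z. f z * z powi n \<partial>circle)" for n
    using assms(2) by (intro integral_cong_AE) auto
  ultimately show ?thesis
    using assms(1) by (simp add: fourier_null_def)
qed

lemma fourier_null_mult_power_int:
  assumes "fourier_null f"
  shows "fourier_null (\<lambda>z. f z * z powi m)"
proof -
  have [measurable]: "f \<in> borel_measurable circle"
    using assms by (auto simp: fourier_null_def)
  have "(\<integral>z. f z * z powi m * z powi n \<partial>circle) = (\<integral>z. f z * z powi (m + n) \<partial>circle)" for n
  proof (rule integral_cong_AE)
    show "AE z in circle. f z * z powi m * z powi n = f z * z powi (m + n)"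
      using AE_circle_norm
    proof eventually_elim
      case (elim z)
      then have "z \<noteq> 0" by auto
      then show ?case by (simp add: power_int_add)
    qed
  qed measurable
  with assms show ?thesis
    by (simp add: fourier_null_def integrable_mult_power_int)
qed

text \<open>The induction runs over all \<open>f\<close> at once: for a product, the second factor
  is applied to \<open>f\<close> times the first, which is again null. A linear form is a
  combination of \<open>z\<close> and \<open>cnj z\<close>, and on the circle \<open>cnj z\<close>
  is 1/z.\<close>

lemma fourier_null_mult_polynomial:
  assumes "real_polynomial_function p" "fourier_null f"
  shows "fourier_null (\<lambda>z. f z * of_real (p z))"
  using assms
proof (induction p arbitrary: f rule: real_polynomial_function.induct)
  case (linear p)
  have [measurable]: "f \<in> borel_measurable circle"
    using linear by (auto simp: fourier_null_def)
  have [measurable]: "p \<in> borel_measurable borel"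
    using linear(1) by (intro borel_measurable_continuous_onI linear_continuous_on)
  have p: "p z = Re z * p 1 + Im z * p \<i>" for z
  proof -
    have "p z = p (Re z *\<^sub>R 1 + Im z *\<^sub>R \<i>)"
      by (rule arg_cong[where f = p]) (simp add: complex_eq_iff)
    also have "\<dots> = Re z * p 1 + Im z * p \<i>"
      by (simp only: linear_add[OF bounded_linear.linear[OF linear(1)]]
          linear_scale[OF bounded_linear.linear[OF linear(1)]] real_scaleR_def)
    finally show ?thesis .
  qed
  \<comment> \<open>Coefficients from \<open>Re z = (z + cnj z) / 2\<close> and
    \<open>Im z = (z - cnj z) / (2 * \<i>)\<close>.\<close>
  define a where "a = (of_real (p 1) - \<i> * of_real (p \<i>)) / (2 :: complex)"
  define b where "b = (of_real (p 1) + \<i> * of_real (p \<i>)) / (2 :: complex)"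
  have "fourier_null (\<lambda>z. a * (f z * z powi 1) + b * (f z * z powi (-1)))"
    by (intro fourier_null_add fourier_null_mult_const fourier_null_mult_power_int linear)
  then show ?case
  proof (rule fourier_null_cong_AE)
    show "AE z in circle. a * (f z * z powi 1) + b * (f z * z powi (-1)) = f z * of_real (p z)"
      using AE_circle_norm
    proof eventually_elim
      case (elim z)
      have inv: "z powi (-1) = cnj z"
        using divide_conv_cnj[OF elim, of 1] by (simp add: power_int_minus divide_inverse)
      have "a * (f z * z powi 1) + b * (f z * z powi (-1)) = f z * (a * z + b * cnj z)"
        unfolding inv power_int_1_right by (simp only: ring_distribs mult_ac)
      also have "a * z + b * cnj z = of_real (p z)"
        unfolding p[of z] a_def b_def by (simp add: complex_eq_iff field_simps)
      finally show ?case .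
    qed
  qed measurable
next
  case (const c)
  then show ?case
    using fourier_null_mult_const[of f "of_real c"] by (simp add: mult.commute)
next
  case (add p q)
  then show ?case
    using fourier_null_add[OF add.IH(1) add.IH(2), of f f] by (simp add: distrib_left)
next
  case (mult p q)
  then show ?case
    using mult.IH(2)[OF mult.IH(1)[of f]] by (simp add: mult.assoc)
qed

text \<open>Stone-Weierstrass on the unit circle: replacing \<open>g\<close> by a polynomial within
  \<open>e\<close> costs at most \<open>e\<close> times the L1 norm of \<open>f\<close>, and the
  polynomial part integrates to 0.\<close>

lemma fourier_null_integral_continuous:
  fixes g :: "complex \<Rightarrow> real"
  assumes f: "fourier_null f" and g: "continuous_on UNIV g"
  shows "(\<integral>z. f z * of_real (g z) \<partial>circle) = 0"
proof -
  have [measurable]: "f \<in> borel_measurable circle" and fi: "integrable circle f"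
    using f by (auto simp: fourier_null_def)
  have [measurable]: "g \<in> borel_measurable borel"
    using g by (rule borel_measurable_continuous_onI)
  define L where "L = (\<integral>z. norm (f z) \<partial>circle)"
  have bound: "norm (\<integral>z. f z * of_real (g z) \<partial>circle) \<le> e * L" if "e > 0" for e
  proof -
    obtain p where p: "real_polynomial_function p" "\<And>z. z \<in> sphere 0 1 \<Longrightarrow> \<bar>g z - p z\<bar> < e"
      using Stone_Weierstrass_real_polynomial_function[OF compact_sphere continuous_on_subset[OF g subset_UNIV] \<open>e > 0\<close>]
      by blast
    have "fourier_null (\<lambda>z. f z * of_real (p z))"
      by (rule fourier_null_mult_polynomial[OF p(1) f])
    then have pi: "integrable circle (\<lambda>z. f z * of_real (p z))"
      and p0: "(\<integral>z. f z * of_real (p z) \<partial>circle) = 0"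
      using power_int_0_right unfolding fourier_null_def by (auto dest: spec[of _ 0])
    have [measurable]: "p \<in> borel_measurable borel"
      using p(1) by (intro borel_measurable_continuous_onI continuous_at_imp_continuous_on)
        (auto intro: continuous_real_polymonial_function)
    have AE: "AE z in circle. norm (f z * of_real (g z - p z)) \<le> e * norm (f z)"
      using AE_circle_norm
    proof eventually_elim
      case (elim z)
      then have "\<bar>g z - p z\<bar> \<le> e"
        using p(2)[of z] by simp
      then have "norm (f z) * \<bar>g z - p z\<bar> \<le> norm (f z) * e"
        by (intro mult_left_mono) auto
      then show ?case
        by (simp add: norm_mult mult.commute del: of_real_diff)
    qed
    have di: "integrable circle (\<lambda>z. f z * of_real (g z - p z))"
      using AE by (intro Bochner_Integration.integrable_bound[OF integrable_mult_right[OF integrable_norm[OF fi], of e]])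
        (auto elim!: eventually_mono)
    have "(\<integral>z. f z * of_real (g z) \<partial>circle)
        = (\<integral>z. f z * of_real (g z - p z) + f z * of_real (p z) \<partial>circle)"
      by (simp add: algebra_simps)
    also have "\<dots> = (\<integral>z. f z * of_real (g z - p z) \<partial>circle)"
      using Bochner_Integration.integral_add[OF di pi] p0 by simp
    also have "norm \<dots> \<le> (\<integral>z. norm (f z * of_real (g z - p z)) \<partial>circle)"
      by (rule integral_norm_bound)
    also have "\<dots> \<le> (\<integral>z. e * norm (f z) \<partial>circle)"
      by (rule integral_mono_AE[OF _ _ AE]) (use di fi in auto)
    finally show ?thesis
      by (simp add: L_def)
  qed
  have "L \<ge> 0"
    by (simp add: L_def)
  have "norm (\<integral>z. f z * of_real (g z) \<partial>circle) \<le> 0 + e" if "e > 0" for e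
  proof -
    \<comment> \<open>Dividing by \<open>L + 1\<close> rather than \<open>L\<close> covers
      \<open>L = 0\<close>.\<close>
    have "norm (\<integral>z. f z * of_real (g z) \<partial>circle) \<le> e / (L + 1) * L"
      using that \<open>L \<ge> 0\<close> by (intro bound) (simp add: add_nonneg_pos)
    also have "\<dots> \<le> e"
      using that \<open>L \<ge> 0\<close> by (simp add: field_simps)
    finally show ?thesis by simp
  qed
  then show ?thesis
    using field_le_epsilon[of "norm (\<integral>z. f z * of_real (g z) \<partial>circle)" 0] by simp
qed

text \<open>The continuous functions \<open>max 0 (1 - real k * infdist z C)\<close> decrease to the
  indicator of \<open>C\<close>, and \<open>norm (f z)\<close> dominates. The empty set is treated
  separately because \<open>infdist\<close> to it is 0 by convention.\<close>

lemma fourier_null_set_integral_closed: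
  assumes f: "fourier_null f" and C: "closed C"
  shows "(LINT z:C|circle. f z) = 0"
proof (cases "C = {}")
  case False
  have [measurable]: "f \<in> borel_measurable circle" and fi: "integrable circle f"
    using f by (auto simp: fourier_null_def)
  have [measurable]: "C \<in> sets borel"
    using C by simp
  define g where "g k z = max 0 (1 - real k * infdist z C)" for k z
  have g: "continuous_on UNIV (g k)" for k
    unfolding g_def by (intro continuous_intros)
  have [measurable]: "g k \<in> borel_measurable borel" for k
    using g by (rule borel_measurable_continuous_onI)
  have lim: "(\<lambda>k. g k z) \<longlonglongrightarrow> indicator C z" for z
  proof (cases "z \<in> C")
    case True
    then show ?thesis by (simp add: g_def)
  next
    case z: False
    then have "infdist z C > 0"
      using in_closed_iff_infdist_zero[OF C False] infdist_nonneg[of z C] by (metis less_eq_real_def)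
    then obtain K :: nat where K: "1 < real K * infdist z C"
      using reals_Archimedean3 by blast
    have "\<forall>\<^sub>F k in sequentially. g k z = 0"
    proof (rule eventually_sequentiallyI[of K])
      fix k assume "K \<le> k"
      then have "real K * infdist z C \<le> real k * infdist z C"
        by (intro mult_right_mono infdist_nonneg) simp
      with K show "g k z = 0"
        by (simp add: g_def)
    qed
    then show ?thesis
      using z by (simp add: tendsto_eventually)
  qed
  have "(\<lambda>k. \<integral>z. f z * of_real (g k z) \<partial>circle) \<longlonglongrightarrow> (\<integral>z. f z * of_real (indicator C z) \<partial>circle)"
  proof (rule integral_dominated_convergence[where w = "\<lambda>z. norm (f z)"])
    show "AE z in circle. (\<lambda>k. f z * of_real (g k z)) \<longlonglongrightarrow> f z * of_real (indicator C z)"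
      by (intro AE_I2 tendsto_intros lim)
    have "\<bar>g k z\<bar> \<le> 1" for k z
      using infdist_nonneg[of z C] by (simp add: g_def)
    then show "AE z in circle. norm (f z * of_real (g k z)) \<le> norm (f z)" for k
      by (intro AE_I2) (simp add: norm_mult mult_left_le)
  qed (use fi in \<open>auto\<close>)
  then have "(\<integral>z. f z * of_real (indicator C z) \<partial>circle) = 0"
    by (simp add: fourier_null_integral_continuous[OF f g] LIMSEQ_const_iff)
  then show ?thesis
    by (simp add: set_lebesgue_integral_def scaleR_conv_of_real mult.commute)
qed (simp add: set_lebesgue_integral_def)

text \<open>Dynkin's argument: closed sets are stable under intersection and generate the Borel
  sets, and vanishing of the integral passes to complements and countable disjoint unions.\<close>

lemma fourier_null_set_integral:
  assumes f: "fourier_null f" and "A \<in> sets borel"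
  shows "(LINT z:A|circle. f z) = 0"
proof -
  have [measurable]: "f \<in> borel_measurable circle" and fi: "integrable circle f"
    using f by (auto simp: fourier_null_def)
  have si: "set_integrable circle A f" if "A \<in> sets borel" for A
    using that unfolding set_integrable_def by (intro integrable_mult_indicator fi) auto
  have "Int_stable (Collect (closed :: complex set \<Rightarrow> bool))"
    by (auto simp: Int_stable_def)
  moreover have "Collect (closed :: complex set \<Rightarrow> bool) \<subseteq> Pow UNIV"
    by simp
  moreover have "A \<in> sigma_sets UNIV (Collect closed)"
    using assms(2) by (simp add: borel_eq_closed)
  ultimately show ?thesis
  proof (induction rule: sigma_sets_induct_disjoint)
    case (basic A)
    then show ?case
      by (simp add: fourier_null_set_integral_closed[OF f])
  next
    case empty
    show ?case by (simp add: set_lebesgue_integral_def)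
  next
    case (compl A)
    then have A: "A \<in> sets borel"
      by (simp add: borel_eq_closed)
    have "(LINT z:A \<union> (UNIV - A)|circle. f z) = (LINT z:A|circle. f z) + (LINT z:UNIV - A|circle. f z)"
      using A by (intro set_integral_Un si) auto
    moreover have "(LINT z:UNIV|circle. f z) = 0"
      by (rule fourier_null_set_integral_closed[OF f closed_UNIV])
    ultimately show ?case
      using compl by simp
  next
    case (union A)
    then have A: "A i \<in> sets borel" for i
      by (auto simp: borel_eq_closed)
    have "(LINT z:(\<Union>i. A i)|circle. f z) = (\<Sum>i. LINT z:A i|circle. f z)"
      using A union(1) by (intro lebesgue_integral_countable_add si) (auto simp: disjoint_family_on_def)
    then show ?case
      using union by simp
  qed
qed

text \<open>A function whose integral over every Borel set vanishes is 0 almost everywhere. This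
  lets identities between elements of \<open>hardy\<close> be checked one coefficient at a
  time.\<close>

lemma eq_0_if_fourier_coefficients_0:
  assumes "\<And>n. cinner f (monomial n) = 0"
  shows "f = 0"
  using assms
proof transfer
  fix f assume f: "l2_rel f f" and coeff: "\<And>n. (\<integral>z. f z * cnj (z powi n) \<partial>circle) = 0"
  have sq: "square_integrable f"
    using f by (simp add: l2_rel_def)
  have [measurable]: "f \<in> borel_measurable circle" and fi: "integrable circle f"
    using sq square_integrable_imp_integrable[OF sq] by (auto simp: square_integrable_def)
  have "(\<integral>z. f z * z powi n \<partial>circle) = 0" for n
  proof -
    have "(\<integral>z. f z * z powi n \<partial>circle) = (\<integral>z. f z * cnj (z powi (- n)) \<partial>circle)"
    proof (rule integral_cong_AE)
      show "AE z in circle. f z * z powi n = f z * cnj (z powi (- n))"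
        using AE_circle_norm
      proof eventually_elim
        case (elim z)
        then show ?case
          unfolding cnj_power_int_circle[OF elim] by simp
      qed
    qed measurable
    then show ?thesis by (simp only: coeff)
  qed
  then have "fourier_null f"
    by (simp add: fourier_null_def fi)
  then have "(LINT z:A|circle. f z) = 0" if "A \<in> sets circle" for A
    using fourier_null_set_integral that by simp
  then have "AE z in circle. f z = 0"
    by (rule sigma_finite_measure.density_zero[OF finite_measure.axioms(1)[OF finite_measure_circle] fi])
  then show "l2_rel f (\<lambda>_. 0)"
    using f by (simp add: l2_rel_def square_integrable_def)
qed

section \<open>Complex orthogonality and antilinear symmetric operators\<close>

lemma cinner_add_right: "cinner f (g + h) = cinner f g + cinner f h"
  using cinner_add_left[of g h f] by (metis cinner_commute complex_cnj_add)

lemma cinner_scaleC_right: "cinner f (scaleC c g) = cnj c * cinner f g"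
  using cinner_scaleC_left[of c g f] by (metis cinner_commute complex_cnj_mult)

lemma scaleC_of_real: "scaleC (of_real r) f = r *\<^sub>R f"
  by (simp add: scaleR_l2_def)

lemma cinner_self: "cinner f f = of_real ((norm f)\<^sup>2)"
proof -
  have "Im (cinner f f) = 0"
    using cinner_commute[of f f] by (simp add: complex_eq_iff)
  then show ?thesis
    by (simp add: complex_eq_iff norm_l2_def cinner_self_nonneg)
qed

lemma norm_scaleC: "norm (scaleC c f) = norm c * norm f"
proof -
  have "complex_of_real ((norm (scaleC c f))\<^sup>2) = of_real ((norm c * norm f)\<^sup>2)"
    unfolding cinner_self[symmetric] cinner_scaleC_left cinner_scaleC_right
    by (simp add: cinner_self power_mult_distrib complex_norm_square flip: of_real_power)
  then show ?thesis
    by (simp only: of_real_eq_iff power2_eq_iff_nonneg norm_ge_zero mult_nonneg_nonneg)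
qed

text \<open>Rotating \<open>f\<close> by a unimodular \<open>c\<close> makes the inner product real
  and nonnegative, where the real Cauchy-Schwarz inequality applies.\<close>

lemma norm_cinner_le: "norm (cinner f g) \<le> norm f * norm g"
proof (cases "cinner f g = 0")
  case False
  define c where "c = cnj (sgn (cinner f g))"
  have "norm c = 1"
    using False by (simp add: c_def norm_sgn)
  have "c * cinner f g = of_real (norm (cinner f g))"
    using False complex_norm_square[of "cinner f g"]
    by (simp add: c_def sgn_eq field_simps power2_eq_square)
  then have "norm (cinner f g) = Re (c * cinner f g)"
    by simp
  also have "\<dots> = inner (scaleC c f) g"
    by (simp add: inner_l2_def cinner_scaleC_left)
  also have "\<dots> \<le> norm (scaleC c f) * norm g"
    by (rule norm_cauchy_schwarz)
  finally show ?thesis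
    by (simp add: norm_scaleC \<open>norm c = 1\<close>)
qed simp

lemma bounded_bilinear_cinner: "bounded_bilinear cinner"
proof
  show "cinner (r *\<^sub>R f) g = r *\<^sub>R cinner f g" "cinner f (r *\<^sub>R g) = r *\<^sub>R cinner f g" for r f g
    by (simp_all add: cinner_scaleC_left cinner_scaleC_right scaleR_conv_of_real flip: scaleC_of_real)
  show "\<exists>K. \<forall>f g. norm (cinner f g) \<le> norm f * norm g * K"
    by (rule exI[of _ 1]) (simp add: norm_cinner_le)
qed (simp_all add: cinner_add_left cinner_add_right)

lemmas continuous_on_cinner [continuous_intros] = bounded_bilinear.continuous_on[OF bounded_bilinear_cinner]
  and cinner_diff_left = bounded_bilinear.diff_left[OF bounded_bilinear_cinner]
  and cinner_0_left [simp] = bounded_bilinear.zero_left[OF bounded_bilinear_cinner]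
  and cinner_0_right [simp] = bounded_bilinear.zero_right[OF bounded_bilinear_cinner]

lemma cinner_self_eq_0_iff: "cinner f f = 0 \<longleftrightarrow> f = 0"
  by (simp add: cinner_self)

lemma cinner_eqI:
  assumes "\<And>h. cinner f h = cinner g h"
  shows "f = g"
proof -
  have "cinner (f - g) (f - g) = 0"
    by (subst cinner_diff_left) (simp add: assms)
  then show ?thesis
    by (simp add: cinner_self_eq_0_iff)
qed

lemma bounded_linear_scaleC: "bounded_linear (scaleC c)"
proof (rule bounded_linear_intro[where K = "norm c"])
  show "scaleC c (r *\<^sub>R f) = r *\<^sub>R scaleC c f" for r f
    by (simp add: mult.commute flip: scaleC_of_real)
qed (simp_all add: l2.scale_right_distrib norm_scaleC mult.commute)

lemma csubspace_imp_subspace: "l2.subspace V \<Longrightarrow> subspace V"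
  unfolding subspace_def l2.subspace_def by (auto simp flip: scaleC_of_real)

lemma csubspace_closure:
  assumes "l2.subspace V"
  shows "l2.subspace (closure V)"
proof -
  have "f + g \<in> closure V" if "f \<in> closure V" "g \<in> closure V" for f g
  proof -
    obtain s t where st: "\<And>n. s n \<in> V" "s \<longlonglongrightarrow> f" "\<And>n. t n \<in> V" "t \<longlonglongrightarrow> g"
      using \<open>f \<in> closure V\<close> \<open>g \<in> closure V\<close> unfolding closure_sequential by blast
    then have "\<forall>n. s n + t n \<in> V" "(\<lambda>n. s n + t n) \<longlonglongrightarrow> f + g"
      using assms by (auto intro: l2.subspace_add tendsto_add)
    then show ?thesis
      unfolding closure_sequential by (intro exI[of _ "\<lambda>n. s n + t n"] conjI)
  qed
  moreover have "scaleC c f \<in> closure V" if "f \<in> closure V" for c f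
  proof -
    have "scaleC c ` closure V \<subseteq> closure (scaleC c ` V)"
      by (rule closure_bounded_linear_image_subset[OF bounded_linear_scaleC])
    also have "\<dots> \<subseteq> closure V"
      using assms by (intro closure_mono) (auto simp: l2.subspace_def)
    finally show ?thesis using that by auto
  qed
  moreover have "0 \<in> closure V"
    using assms closure_subset l2.subspace_0 by blast
  ultimately show ?thesis
    by (simp add: l2.subspace_def)
qed

lemma closure_cspan_minimal:
  "l2.subspace V \<Longrightarrow> closed V \<Longrightarrow> G \<subseteq> V \<Longrightarrow> closure (cspan G) \<subseteq> V"
  by (intro closure_minimal l2.span_minimal)

lemma csubspace_closure_cspan: "l2.subspace (closure (cspan G))"
  by (intro csubspace_closure l2.subspace_span)

text \<open>A definite description of the same shape as \<open>riesz_proj\<close>, so that the Riesz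
  projection is literally the case \<open>V = hardy\<close> and inherits every property of
  projections.\<close>

definition orth_proj :: "l2 set \<Rightarrow> l2 \<Rightarrow> l2" where
  "orth_proj V f = (THE h. h \<in> V \<and> (\<forall>g\<in>V. cinner (f - h) g = 0))"

lemma riesz_proj_eq: "riesz_proj = orth_proj hardy"
  by (simp add: fun_eq_iff riesz_proj_def orth_proj_def)

locale closed_csubspace =
  fixes V :: "l2 set"
  assumes csubspace: "l2.subspace V" and closed: "closed V"
begin

lemma orth_proj_unique:
  assumes "h \<in> V" "\<And>g. g \<in> V \<Longrightarrow> cinner (f - h) g = 0"
  shows "orth_proj V f = h"
  unfolding orth_proj_def
proof (rule the_equality)
  fix k assume k: "k \<in> V \<and> (\<forall>g\<in>V. cinner (f - k) g = 0)"
  then have "h - k \<in> V"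
    using csubspace assms(1) by (simp add: l2.subspace_diff)
  then have "cinner (h - k) (h - k) = 0"
    using k assms(2)[of "h - k"] cinner_diff_left[of "f - k" "f - h" "h - k"] by simp
  then show "k = h"
    by (simp add: cinner_self_eq_0_iff)
qed (use assms in auto)

text \<open>The real projection is already the complex one: testing against \<open>g\<close> and
  \<open>scaleC \<i> g\<close>, both in \<open>V\<close>, kills the real and the imaginary part of
  the complex inner product.\<close>

lemma orth_proj_in: "orth_proj V f \<in> V"
  and orth_proj_orth: "g \<in> V \<Longrightarrow> cinner (f - orth_proj V f) g = 0"
proof -
  obtain h where h: "h \<in> V" "\<And>g. g \<in> V \<Longrightarrow> inner (f - h) g = 0"
    using orthogonal_projection_exists[OF csubspace_imp_subspace[OF csubspace] closed] by blast
  have orth: "cinner (f - h) g = 0" if "g \<in> V" for g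
  proof -
    have "scaleC \<i> g \<in> V"
      using csubspace that by (rule l2.subspace_scale)
    from h(2)[OF this] h(2)[OF that] show ?thesis
      by (simp add: inner_l2_def cinner_scaleC_right complex_eq_iff)
  qed
  have "orth_proj V f = h"
    by (rule orth_proj_unique[OF h(1) orth])
  with h(1) orth show "orth_proj V f \<in> V" "g \<in> V \<Longrightarrow> cinner (f - orth_proj V f) g = 0"
    by auto
qed

lemma orth_proj_id: "f \<in> V \<Longrightarrow> orth_proj V f = f"
  by (rule orth_proj_unique) auto

lemma orth_proj_add: "orth_proj V (f + g) = orth_proj V f + orth_proj V g"
proof (rule orth_proj_unique)
  fix h assume "h \<in> V"
  then show "cinner (f + g - (orth_proj V f + orth_proj V g)) h = 0"
    using orth_proj_orth[of h f] orth_proj_orth[of h g]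
    by (simp add: cinner_add_left cinner_diff_left)
qed (use csubspace in \<open>simp add: l2.subspace_add orth_proj_in\<close>)

lemma orth_proj_scaleC: "orth_proj V (scaleC c f) = scaleC c (orth_proj V f)"
proof (rule orth_proj_unique)
  fix h assume "h \<in> V"
  then show "cinner (scaleC c f - scaleC c (orth_proj V f)) h = 0"
    using orth_proj_orth[of h f] by (simp add: cinner_scaleC_left flip: l2.scale_right_diff_distrib)
qed (use csubspace in \<open>simp add: l2.subspace_scale orth_proj_in\<close>)

lemma cinner_orth_proj: "g \<in> V \<Longrightarrow> cinner (orth_proj V f) g = cinner f g"
  using orth_proj_orth[of g f] by (simp add: cinner_diff_left)

lemma cinner_orth_proj': "g \<in> V \<Longrightarrow> cinner g (orth_proj V f) = cinner g f"
  by (metis cinner_commute cinner_orth_proj)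

lemma norm_orth_proj_le: "norm (orth_proj V f) \<le> norm f"
proof -
  have "complex_of_real ((norm (orth_proj V f))\<^sup>2) = cinner f (orth_proj V f)"
    by (simp only: cinner_self[symmetric] cinner_orth_proj orth_proj_in)
  then have "(norm (orth_proj V f))\<^sup>2 \<le> norm f * norm (orth_proj V f)"
    using norm_cinner_le[of f "orth_proj V f"] by (metis norm_of_real abs_power2)
  then show ?thesis
    by (simp add: power2_eq_square mult_le_cancel_right) (metis norm_ge_zero norm_zero order_less_le)
qed

lemma bounded_linear_orth_proj: "bounded_linear (orth_proj V)"
proof (rule bounded_linear_intro[where K = 1])
  show "orth_proj V (r *\<^sub>R f) = r *\<^sub>R orth_proj V f" for r f
    by (simp add: orth_proj_scaleC flip: scaleC_of_real)
qed (simp_all add: orth_proj_add norm_orth_proj_le)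

end

section \<open>Cyclic subspaces\<close>

lemma closed_csubspace_closure_cspan: "closed_csubspace (closure (cspan G))"
  by (simp add: closed_csubspace_def csubspace_closure_cspan)

lemma cyclic_subspace_minimal:
  assumes "closed_csubspace V" "v \<in> V" "A ` V \<subseteq> V"
  shows "cyclic_subspace A v \<subseteq> V"
proof -
  have "(A ^^ n) v \<in> V" for n
    using assms by (induction n) auto
  then show ?thesis
    using assms(1) unfolding cyclic_subspace_def closed_csubspace_def
    by (intro closure_cspan_minimal) auto
qed

lemma closed_csubspace_cyclic_subspace: "closed_csubspace (cyclic_subspace A v)"
  by (simp add: cyclic_subspace_def closed_csubspace_closure_cspan)

lemma power_in_cyclic_subspace: "(A ^^ n) v \<in> cyclic_subspace A v"
  unfolding cyclic_subspace_def by (intro closure_subset[THEN subsetD] l2.span_base rangeI)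

lemma cyclic_subspace_invariant:
  assumes A: "bounded_linear A" "\<And>c f. A (scaleC c f) = scaleC c (A f)"
  shows "A ` cyclic_subspace A v \<subseteq> cyclic_subspace A v"
proof -
  interpret A: bounded_linear A by fact
  interpret V: closed_csubspace "cyclic_subspace A v"
    by (rule closed_csubspace_cyclic_subspace)
  have "cyclic_subspace A v \<subseteq> A -` cyclic_subspace A v"
    unfolding cyclic_subspace_def[of A v, symmetric]
  proof (subst cyclic_subspace_def, rule closure_cspan_minimal)
    show "l2.subspace (A -` cyclic_subspace A v)"
      using V.csubspace by (auto simp: l2.subspace_def A.add A.zero A(2))
    show "closed (A -` cyclic_subspace A v)"
      by (intro continuous_closed_vimage V.closed A.isCont) simp
    have "A ((A ^^ n) v) \<in> cyclic_subspace A v" for n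
      using power_in_cyclic_subspace[where n = "Suc n" and A = A and v = v] by simp
    then show "range (\<lambda>n. (A ^^ n) v) \<subseteq> A -` cyclic_subspace A v"
      by auto
  qed
  then show ?thesis by auto
qed

text \<open>The orbit of \<open>v\<close> stays in \<open>X\<close>, so values off \<open>X\<close>
  do not matter. This permits passing between a restricted operator, \<open>hankel u\<close> itself,
  and its extension through the projection onto the range.\<close>

lemma cyclic_subspace_cong:
  assumes "\<And>f. f \<in> X \<Longrightarrow> A f = B f" "\<And>f. f \<in> X \<Longrightarrow> A f \<in> X" "v \<in> X"
  shows "cyclic_subspace A v = cyclic_subspace B v"
proof -
  have "(A ^^ n) v = (B ^^ n) v \<and> (A ^^ n) v \<in> X" for n
    by (induction n) (use assms in auto)
  then show ?thesis
    by (simp add: cyclic_subspace_def)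
qed

text \<open>Symmetry in the form suited to antilinear maps. It implies additivity and antilinearity,
  because the right-hand side is antilinear in \<open>f\<close> for any \<open>K\<close>.\<close>

locale symmetric_antilinear =
  fixes K :: "l2 \<Rightarrow> l2" and C :: real
  assumes symmetric: "cinner (K f) g = cinner (K g) f"
    and bounded: "norm (K f) \<le> C * norm f"
begin

lemma add: "K (f + g) = K f + K g"
proof (rule cinner_eqI)
  show "cinner (K (f + g)) h = cinner (K f + K g) h" for h
    by (simp only: cinner_add_left cinner_add_right symmetric[of _ h])
qed

lemma scaleC: "K (scaleC c f) = scaleC (cnj c) (K f)"
proof (rule cinner_eqI)
  show "cinner (K (scaleC c f)) h = cinner (scaleC (cnj c) (K f)) h" for h
    by (simp only: cinner_scaleC_left cinner_scaleC_right symmetric[of _ h])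
qed

text \<open>\<open>bounded_linear\<close> refers to real scalars, so an antilinear operator
  qualifies.\<close>

lemma bounded_linear: "bounded_linear K"
  by (rule bounded_linear_intro[where K = C])
    (simp_all add: add bounded scaleC mult.commute flip: scaleC_of_real)

lemma bounded_linear_square: "bounded_linear (\<lambda>f. K (K f))"
  by (rule bounded_linear_compose[OF bounded_linear bounded_linear])

lemma square_selfadjoint: "cinner (K (K f)) g = cinner f (K (K g))"
  by (metis cinner_commute symmetric)

text \<open>With \<open>P\<close> the projection onto \<open>V\<close>, the form \<open>\<langle>K (w - P w), P w'\<rangle>\<close> does not change when \<open>K\<^sup>2\<close> is
  moved from one argument to the other. It is therefore symmetric on the powers \<open>K\<^sup>2\<^sup>n v\<close>, hence on
  the whole cyclic subspace, and vanishes when \<open>w\<close> is in \<open>V\<close>.\<close>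

lemma invariant_subspace:
  assumes V: "closed_csubspace V" and inv: "\<And>f. f \<in> V \<Longrightarrow> K (K f) \<in> V"
    and X: "V \<subseteq> cyclic_subspace (\<lambda>f. K (K f)) v"
    and w: "w \<in> V" "K w \<in> cyclic_subspace (\<lambda>f. K (K f)) v"
  shows "K w \<in> V"
proof -
  interpret V: closed_csubspace V by fact
  interpret K: bounded_linear K by (rule bounded_linear)
  interpret P: bounded_linear "orth_proj V" by (rule V.bounded_linear_orth_proj)
  define A where "A f = K (K f)" for f
  let ?X = "cyclic_subspace A v"
  note X = X[folded A_def] and w = w[folded A_def]
  interpret X: closed_csubspace ?X
    by (rule closed_csubspace_cyclic_subspace)
  define b where "b f g = cinner (K (f - orth_proj V f)) (orth_proj V g)" for f g
  \<comment> \<open>The square of \<open>K\<close> is self-adjoint, so its invariant subspace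
    \<open>V\<close> is reducing and the projection commutes with it.\<close>
  have P_A: "orth_proj V (A f) = A (orth_proj V f)" for f
  proof (rule V.orth_proj_unique)
    show "A (orth_proj V f) \<in> V"
      unfolding A_def by (rule inv[OF V.orth_proj_in])
    show "cinner (A f - A (orth_proj V f)) g = 0" if "g \<in> V" for g
      using V.orth_proj_orth[OF inv[OF that], of f]
      unfolding A_def by (simp add: square_selfadjoint flip: K.diff)
  qed
  have move: "b (A f) g = b f (A g)" for f g
    unfolding b_def P_A unfolding A_def by (simp add: square_selfadjoint flip: K.diff)
  \<comment> \<open>With all powers moved to the left argument only \<open>j + k\<close> remains, so
    symmetry on the orbit is commutativity of addition.\<close>
  have "b ((A ^^ j) v) ((A ^^ k) v) = b ((A ^^ (j + k)) v) v" for j k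
  proof (induction k arbitrary: j)
    case (Suc k)
    have "b ((A ^^ j) v) ((A ^^ Suc k) v) = b ((A ^^ Suc j) v) ((A ^^ k) v)"
      by (simp add: move)
    also have "\<dots> = b ((A ^^ (j + Suc k)) v) v"
      using Suc.IH[of "Suc j"] by simp
    finally show ?case .
  qed simp
  then have gen: "b ((A ^^ j) v) ((A ^^ k) v) = b ((A ^^ k) v) ((A ^^ j) v)" for j k
    by (simp add: add.commute)
  \<comment> \<open>\<open>b\<close> is antilinear in both arguments, in the first through
    \<open>K\<close> and in the second through \<open>cinner\<close>. Hence the \<open>f\<close>
    with \<open>b f g = b g f\<close> form a complex subspace; for a sesquilinear form this could
    fail.\<close>
  have closed_sub: "l2.subspace {f. b f g = b g f} \<and> closed {f. b f g = b g f}" for g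
  proof
    have 1: "b (f + f') g = b f g + b f' g" "b g (f + f') = b g f + b g f'"
      "b (scaleC c f) g = cnj c * b f g" "b g (scaleC c f) = cnj c * b g f" for f f' g c
      unfolding b_def
      by (simp_all add: add_diff_add add V.orth_proj_add V.orth_proj_scaleC scaleC cinner_add_left
          cinner_add_right cinner_scaleC_left cinner_scaleC_right flip: l2.scale_right_diff_distrib)
    have 2: "b 0 g = 0" "b g 0 = 0"
      by (simp_all add: b_def P.zero K.zero)
    show "l2.subspace {f. b f g = b g f}"
      unfolding l2.subspace_def by (simp add: 1 2)
    show "closed {f. b f g = b g f}"
      unfolding b_def
      by (intro closed_Collect_eq continuous_intros K.continuous_on P.continuous_on)
  qed
  have "b f ((A ^^ k) v) = b ((A ^^ k) v) f" if "f \<in> ?X" for f k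
  proof -
    have "?X \<subseteq> {f. b f ((A ^^ k) v) = b ((A ^^ k) v) f}"
      unfolding cyclic_subspace_def using closed_sub gen by (intro closure_cspan_minimal) auto
    with that show ?thesis by auto
  qed
  then have b_sym: "b g f = b f g" if "f \<in> ?X" "g \<in> ?X" for f g
  proof -
    have "?X \<subseteq> {g. b g f = b f g}"
      unfolding cyclic_subspace_def using closed_sub that(1) \<open>\<And>f k. f \<in> ?X \<Longrightarrow> b f ((A ^^ k) v) = b ((A ^^ k) v) f\<close>
      by (intro closure_cspan_minimal) auto
    with that show ?thesis by auto
  qed
  \<comment> \<open>The part of \<open>K w\<close> outside \<open>V\<close>. Its projection is 0
    while \<open>w\<close> is its own projection, so \<open>b x w\<close> is
    \<open>cinner (K x) w\<close>, which is \<open>cinner (K w) x\<close>, and \<open>b w x\<close>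
    is 0; and \<open>cinner (K w) x\<close> is the squared norm of \<open>x\<close>.\<close>
  define x where "x = K w - orth_proj V (K w)"
  have "x \<in> ?X"
    unfolding x_def using w(2) X V.orth_proj_in X.csubspace by (intro l2.subspace_diff) auto
  have "orth_proj V x = 0"
    by (simp add: x_def P.diff V.orth_proj_id V.orth_proj_in)
  then have "cinner (K x) w = b x w" "b w x = 0"
    using w(1) by (simp_all add: b_def V.orth_proj_id)
  then have "cinner (K w) x = 0"
    using b_sym[of w x] \<open>x \<in> ?X\<close> w(1) X by (metis subsetD symmetric)
  moreover have "cinner x (orth_proj V (K w)) = 0"
    unfolding x_def by (rule V.orth_proj_orth[OF V.orth_proj_in])
  ultimately have "cinner x x = 0"
    by (metis cinner_commute cinner_diff_left complex_cnj_zero diff_zero x_def)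
  then have "K w = orth_proj V (K w)"
    by (simp add: cinner_self_eq_0_iff x_def)
  then show ?thesis
    using V.orth_proj_in by metis
qed

end

section \<open>The shift and polynomials\<close>

lemma square_integrable_cnj_mult: "square_integrable f \<Longrightarrow> square_integrable (\<lambda>z. cnj z * f z)"
proof -
  assume "square_integrable f"
  moreover have "continuous_on UNIV cnj"
    by (intro continuous_intros)
  ultimately have "square_integrable (\<lambda>z. f z * cnj z)"
    using square_integrable_continuous(2) by blast
  then show ?thesis by (simp only: mult.commute)
qed

text \<open>On the circle \<open>cnj z\<close> is 1/z, so this is both the inverse and the adjoint
  of \<open>shift\<close> in all of L2. Its compression to \<open>hardy\<close> is S^*.\<close>

lift_definition unshift :: "l2 \<Rightarrow> l2" is "\<lambda>f z. cnj z * f z"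
  by (auto simp: l2_rel_def square_integrable_cnj_mult)

lemma cinner_shift_left: "cinner (shift f) g = cinner f (unshift g)"
  by transfer (simp add: mult_ac)

lemma cinner_unshift_left: "cinner (unshift f) g = cinner f (shift g)"
  using cinner_commute[of "unshift f" g] cinner_commute[of f "shift g"] by (simp add: cinner_shift_left)

lemma shift_unshift: "shift (unshift f) = f"
  and unshift_shift: "unshift (shift f) = f"
proof -
  have "l2_rel (\<lambda>z. z * (cnj z * f z)) f" if "l2_rel f f" for f
  proof -
    have f: "square_integrable f"
      using that by (simp add: l2_rel_def)
    have "AE z in circle. z * (cnj z * f z) = f z"
      using AE_circle_norm
    proof eventually_elim
      case (elim z)
      then have "z * cnj z = 1"
        by (simp add: complex_norm_square[symmetric])
      then show ?case
        by (simp only: mult.assoc[symmetric] mult_1)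
    qed
    moreover have "square_integrable (\<lambda>z. cnj z * f z * z)"
      by (rule square_integrable_continuous(2)[OF continuous_on_id square_integrable_cnj_mult[OF f]])
    ultimately show ?thesis
      using f by (simp add: l2_rel_def mult_ac)
  qed
  note * = this
  show "shift (unshift f) = f"
    by transfer (rule *)
  show "unshift (shift f) = f"
    by transfer (simp only: * mult.left_commute)
qed

lemma shift_add: "shift (f + g) = shift f + shift g"
  by (rule cinner_eqI) (simp add: cinner_shift_left cinner_add_left)

lemma shift_scaleC: "shift (scaleC c f) = scaleC c (shift f)"
  by (rule cinner_eqI) (simp add: cinner_shift_left cinner_scaleC_left)

lemma unshift_add: "unshift (f + g) = unshift f + unshift g"
  by (rule cinner_eqI) (simp add: cinner_unshift_left cinner_add_left)

lemma unshift_scaleC: "unshift (scaleC c f) = scaleC c (unshift f)"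
  by (rule cinner_eqI) (simp add: cinner_unshift_left cinner_scaleC_left)

lemma norm_shift: "norm (shift f) = norm f"
  by (simp add: norm_l2_def cinner_shift_left unshift_shift)

lemma norm_unshift: "norm (unshift f) = norm f"
  by (simp add: norm_l2_def cinner_unshift_left shift_unshift)

lemma bounded_linear_shift: "bounded_linear shift"
  by (rule bounded_linear_intro[where K = 1])
    (simp_all add: shift_add shift_scaleC norm_shift flip: scaleC_of_real)

lemma bounded_linear_unshift: "bounded_linear unshift"
  by (rule bounded_linear_intro[where K = 1])
    (simp_all add: unshift_add unshift_scaleC norm_unshift flip: scaleC_of_real)

lemma shift_monomial: "shift (monomial n) = monomial (n + 1)"
proof transfer
  fix n :: int
  have sq: "l2_rel (\<lambda>z. z powi m) (\<lambda>z. z powi m)" for m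
    using monomial.rsp by (auto simp: rel_fun_def)
  have "square_integrable (\<lambda>z. z powi n * z)"
    using sq[of n] by (intro square_integrable_continuous(2)[OF continuous_on_id]) (simp add: l2_rel_def)
  moreover have "AE z in circle. z * z powi n = z powi (n + 1)"
    using AE_circle_norm
  proof eventually_elim
    case (elim z)
    then have "z \<noteq> 0" by auto
    then show ?case by (simp add: power_int_add mult.commute)
  qed
  ultimately show "l2_rel (\<lambda>z. z * z powi n) (\<lambda>z. z powi (n + 1))"
    using sq[of "n + 1"] by (simp add: l2_rel_def mult.commute)
qed

lemma unshift_monomial: "unshift (monomial n) = monomial (n - 1)"
  using unshift_shift[of "monomial (n - 1)"] by (simp add: shift_monomial)

lemma hardyD: "f \<in> hardy \<Longrightarrow> n < 0 \<Longrightarrow> cinner f (monomial n) = 0"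
  by (simp add: hardy_def)

lemma closed_csubspace_hardy: "closed_csubspace hardy"
proof
  show "l2.subspace hardy"
    by (auto simp: l2.subspace_def hardy_def cinner_add_left cinner_scaleC_left)
  have "hardy = (\<Inter>n\<in>{..<0}. {f. cinner f (monomial n) = 0})"
    by (auto simp: hardy_def)
  also have "closed \<dots>"
    by (intro closed_INT ballI closed_Collect_eq continuous_intros)
  finally show "closed hardy" .
qed

interpretation hardy: closed_csubspace hardy
  by (rule closed_csubspace_hardy)

lemma monomial_hardy: "0 \<le> n \<Longrightarrow> monomial n \<in> hardy"
  by (simp add: hardy_def cinner_monomial)

lemma shift_hardy: "f \<in> hardy \<Longrightarrow> shift f \<in> hardy"
  by (simp add: hardy_def cinner_shift_left unshift_monomial)

lemma hardy_eqI:
  assumes "f \<in> hardy" "g \<in> hardy" "\<And>n. 0 \<le> n \<Longrightarrow> cinner f (monomial n) = cinner g (monomial n)"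
  shows "f = g"
proof -
  have "cinner (f - g) (monomial n) = 0" for n
    using assms by (cases "n < 0") (simp_all add: cinner_diff_left hardyD)
  then show ?thesis
    using eq_0_if_fourier_coefficients_0[of "f - g"] by simp
qed

lemma hardy_eqI_cinner:
  assumes "f \<in> hardy" "g \<in> hardy" "\<And>h. h \<in> hardy \<Longrightarrow> cinner f h = cinner g h"
  shows "f = g"
  using assms by (intro hardy_eqI) (simp_all add: monomial_hardy)

lemma riesz_proj_hardy: "riesz_proj f \<in> hardy"
  and cinner_riesz_proj: "g \<in> hardy \<Longrightarrow> cinner (riesz_proj f) g = cinner f g"
  and cinner_riesz_proj': "g \<in> hardy \<Longrightarrow> cinner g (riesz_proj f) = cinner g f"
  and riesz_proj_id: "f \<in> hardy \<Longrightarrow> riesz_proj f = f"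
  and riesz_proj_add: "riesz_proj (f + f') = riesz_proj f + riesz_proj f'"
  and riesz_proj_scaleC: "riesz_proj (scaleC c f) = scaleC c (riesz_proj f)"
  and bounded_linear_riesz_proj: "bounded_linear riesz_proj"
  unfolding riesz_proj_eq
  by (simp_all add: hardy.orth_proj_in hardy.cinner_orth_proj hardy.cinner_orth_proj' hardy.orth_proj_id hardy.orth_proj_add
      hardy.orth_proj_scaleC hardy.bounded_linear_orth_proj)

lemma shift_adj_eq: "shift_adj g = riesz_proj (unshift g)"
  unfolding shift_adj_def
proof (rule the_equality)
  show "riesz_proj (unshift g) \<in> hardy \<and>
      (\<forall>f\<in>hardy. cinner (shift f) g = cinner f (riesz_proj (unshift g)))"
    by (simp add: cinner_shift_left cinner_riesz_proj' riesz_proj_hardy)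
  fix h assume h: "h \<in> hardy \<and> (\<forall>f\<in>hardy. cinner (shift f) g = cinner f h)"
  then show "h = riesz_proj (unshift g)"
    by (intro hardy_eqI_cinner)
      (simp_all add: riesz_proj_hardy cinner_riesz_proj cinner_unshift_left cinner_commute[of _ "shift _"]
        cinner_commute[of h])
qed

lemma shift_adj_hardy: "shift_adj g \<in> hardy"
  by (simp add: shift_adj_eq riesz_proj_hardy)

lemma cinner_shift_adj: "f \<in> hardy \<Longrightarrow> cinner (shift_adj g) f = cinner g (shift f)"
  by (simp add: shift_adj_eq cinner_riesz_proj cinner_unshift_left)

lemma bounded_linear_shift_adj: "bounded_linear shift_adj"
  unfolding shift_adj_eq[abs_def]
  by (rule bounded_linear_compose[OF bounded_linear_riesz_proj bounded_linear_unshift])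

lemma shift_adj_scaleC: "shift_adj (scaleC c g) = scaleC c (shift_adj g)"
  by (simp add: shift_adj_eq unshift_scaleC riesz_proj_scaleC)

text \<open>S^* loses exactly the constant coefficient. This defect is the source of the rank one
  difference between the two squared Hankel operators.\<close>

lemma shift_shift_adj:
  assumes "f \<in> hardy"
  shows "shift (shift_adj f) = f - scaleC (cinner f (monomial 0)) (monomial 0)"
proof (rule hardy_eqI)
  fix n :: int assume "0 \<le> n"
  show "cinner (shift (shift_adj f)) (monomial n) =
      cinner (f - scaleC (cinner f (monomial 0)) (monomial 0)) (monomial n)"
  proof (cases "n = 0")
    case True
    then show ?thesis
      by (simp add: cinner_diff_left cinner_scaleC_left cinner_monomial cinner_shift_left
          unshift_monomial hardyD shift_adj_hardy)
  next
    case False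
    with \<open>0 \<le> n\<close> have "monomial (n - 1) \<in> hardy"
      by (intro monomial_hardy) simp
    with False show ?thesis
      by (simp add: cinner_diff_left cinner_scaleC_left cinner_monomial cinner_shift_left
          unshift_monomial cinner_shift_adj shift_monomial)
  qed
qed (use assms hardy.csubspace in \<open>auto intro!: l2.subspace_diff l2.subspace_scale shift_hardy
  shift_adj_hardy monomial_hardy\<close>)

section \<open>Polynomials in the Hardy space and multiplication by their conjugates\<close>

lemma l2_rel_continuous: "continuous_on UNIV f \<Longrightarrow> l2_rel f f"
  by (simp add: l2_rel_def square_integrable_continuous(1))

lemma poly_l2_abs: "poly_l2 p = abs_l2 (poly p)" "l2_rel (poly p) (poly p)"
  by (simp_all add: poly_l2_def l2_rel_continuous continuous_intros)

lemma poly_l2_0: "poly_l2 0 = 0"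
  unfolding poly_l2_abs zero_l2_def by (rule arg_cong[where f = abs_l2]) (simp add: fun_eq_iff)

lemma poly_l2_1: "poly_l2 1 = monomial 0"
  unfolding poly_l2_abs monomial_def map_fun_def
  by (simp, rule arg_cong[where f = abs_l2]) (simp add: fun_eq_iff)

lemma poly_l2_add: "poly_l2 (p + q) = poly_l2 p + poly_l2 q"
  by (simp add: poly_l2_abs plus_l2.abs_eq flip: poly_add)

lemma poly_l2_smult: "poly_l2 (smult c p) = scaleC c (poly_l2 p)"
  by (simp add: poly_l2_abs scaleC.abs_eq flip: poly_smult)

lemma poly_l2_shift: "poly_l2 (pCons 0 p) = shift (poly_l2 p)"
  unfolding poly_l2_abs(1) shift.abs_eq[OF poly_l2_abs(2)]
  by (rule arg_cong[where f = abs_l2]) (simp add: fun_eq_iff)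

lemma poly_l2_monom: "poly_l2 (monom 1 n) = monomial (int n)"
  unfolding poly_l2_abs monomial_def map_fun_def
  by (simp, rule arg_cong[where f = abs_l2]) (simp add: fun_eq_iff poly_monom)

lemma pCons_decompose: "pCons a p = smult a 1 + pCons 0 p"
  by simp

lemma poly_l2_hardy: "poly_l2 p \<in> hardy"
proof (induction p)
  case (pCons a p)
  have "poly_l2 (pCons a p) = scaleC a (monomial 0) + shift (poly_l2 p)"
    by (subst pCons_decompose) (simp only: poly_l2_add poly_l2_smult poly_l2_shift poly_l2_1)
  then show ?case
    using pCons.IH hardy.csubspace
    by (simp add: l2.subspace_add l2.subspace_scale monomial_hardy shift_hardy)
qed (simp add: poly_l2_0 l2.subspace_0[OF hardy.csubspace])

text \<open>Both sides are the integral of \<open>u\<close> times the conjugate of the product of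
  \<open>p\<close> and \<open>q\<close>. The symmetry of the Hankel operator comes from
  here.\<close>

lemma cinner_times_cnj_poly:
  "cinner (times_cnj_poly u p) (poly_l2 q) = cinner (times_cnj_poly u q) (poly_l2 p)"
  by transfer (simp add: mult_ac)

lemma square_integrable_mult_cnj_poly:
  "square_integrable f \<Longrightarrow> square_integrable (\<lambda>z. f z * cnj (poly p z))"
  by (rule square_integrable_continuous(2)) (intro continuous_intros)

lemma times_cnj_poly_1: "times_cnj_poly u 1 = u"
  by transfer simp

lemma times_cnj_poly_add: "times_cnj_poly u (p + q) = times_cnj_poly u p + times_cnj_poly u q"
  by transfer (simp add: l2_rel_def distrib_left square_integrable_add square_integrable_mult_cnj_poly)

lemma times_cnj_poly_smult: "times_cnj_poly u (smult c p) = scaleC (cnj c) (times_cnj_poly u p)"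
proof -
  obtain f where f: "square_integrable f" "u = abs_l2 f"
    by (rule abs_l2_cases)
  then show ?thesis
    by (simp add: times_cnj_poly.abs_eq scaleC.abs_eq l2_rel_refl square_integrable_mult_cnj_poly mult_ac)
qed

lemma times_cnj_poly_shift: "times_cnj_poly u (pCons 0 p) = unshift (times_cnj_poly u p)"
proof -
  obtain f where f: "square_integrable f" "u = abs_l2 f"
    by (rule abs_l2_cases)
  then show ?thesis
    by (simp add: times_cnj_poly.abs_eq unshift.abs_eq l2_rel_refl square_integrable_mult_cnj_poly mult_ac)
qed

section \<open>Hankel operators\<close>

locale hankel_symbol =
  fixes u :: l2
  assumes symbol: "u \<in> hardy"
begin

definition hankel_poly :: "complex poly \<Rightarrow> l2" where
  "hankel_poly p = riesz_proj (times_cnj_poly u p)"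

text \<open>A relation rather than a function: membership records that a vector lies in the domain
  of the closed operator, which the value of \<open>hankel\<close> alone cannot tell.\<close>

definition graph :: "(l2 \<times> l2) set" where
  "graph = closure (hankel_poly_graph u)"

lemma hankel_poly_add: "hankel_poly (p + q) = hankel_poly p + hankel_poly q"
  by (simp add: hankel_poly_def times_cnj_poly_add riesz_proj_add)

lemma hankel_poly_smult: "hankel_poly (smult c p) = scaleC (cnj c) (hankel_poly p)"
  by (simp add: hankel_poly_def times_cnj_poly_smult riesz_proj_scaleC)

lemma hankel_poly_1: "hankel_poly 1 = u"
  by (simp add: hankel_poly_def times_cnj_poly_1 riesz_proj_id symbol)

lemma hankel_poly_0: "hankel_poly 0 = 0"
  using hankel_poly_smult[of 0 0] by simp

lemma hankel_poly_hardy: "hankel_poly p \<in> hardy"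
  by (simp add: hankel_poly_def riesz_proj_hardy)

lemma cinner_hankel_poly: "cinner (hankel_poly p) (poly_l2 q) = cinner (hankel_poly q) (poly_l2 p)"
  by (simp add: hankel_poly_def cinner_riesz_proj poly_l2_hardy cinner_times_cnj_poly)

text \<open>The Hankel property H S = S^* H on polynomials. Iterated from the constant 1, it
  expresses all images through the vectors S^{*n} u.\<close>

lemma hankel_poly_shift: "hankel_poly (pCons 0 p) = shift_adj (hankel_poly p)"
proof (rule hardy_eqI_cinner)
  show "cinner (hankel_poly (pCons 0 p)) h = cinner (shift_adj (hankel_poly p)) h" if "h \<in> hardy" for h
    using that by (simp add: hankel_poly_def times_cnj_poly_shift cinner_riesz_proj cinner_unshift_left
        cinner_shift_adj shift_hardy)
qed (simp_all add: hankel_poly_hardy shift_adj_hardy)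

lemma hankel_poly_pCons: "hankel_poly (pCons a p) = scaleC (cnj a) u + shift_adj (hankel_poly p)"
  by (subst pCons_decompose)
    (simp only: hankel_poly_add hankel_poly_smult hankel_poly_1 hankel_poly_shift)

lemma hankel_poly_graph_eq: "hankel_poly_graph u = range (\<lambda>p. (poly_l2 p, hankel_poly p))"
  by (auto simp: hankel_poly_graph_def hankel_poly_def)

lemma poly_in_graph: "(poly_l2 p, hankel_poly p) \<in> graph"
  unfolding graph_def hankel_poly_graph_eq by (intro closure_subset[THEN subsetD] rangeI)

lemma monomial_0_in_graph: "(monomial 0, u) \<in> graph"
  using poly_in_graph[of 1] by (simp add: poly_l2_1 hankel_poly_1)

lemma zero_in_graph: "(0, 0) \<in> graph"
  using poly_in_graph[of 0] by (simp add: poly_l2_0 hankel_poly_0)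

lemma closed_graph: "closed graph"
  by (simp add: graph_def)

text \<open>The induction principle of the closed operator: closed conditions need checking on
  polynomials only. A condition on two pairs is extended one pair at a time, the other being first a
  polynomial and then arbitrary.\<close>

lemma graph_subset_closed:
  assumes "closed S" "\<And>p. (poly_l2 p, hankel_poly p) \<in> S"
  shows "graph \<subseteq> S"
  unfolding graph_def hankel_poly_graph_eq using assms by (intro closure_minimal) auto

lemma graph_add:
  assumes "(f, f') \<in> graph" "(g, g') \<in> graph"
  shows "(f + g, f' + g') \<in> graph"
proof -
  have closed: "closed {x. (fst x + a, snd x + b) \<in> graph}" for a b
    using continuous_closed_vimage[OF closed_graph, of "\<lambda>x. (fst x + a, snd x + b)"]
    by (simp add: vimage_def continuous_intros)
  have poly: "graph \<subseteq> {x. (fst x + poly_l2 q, snd x + hankel_poly q) \<in> graph}" for q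
    by (rule graph_subset_closed[OF closed]) (simp add: poly_in_graph flip: poly_l2_add hankel_poly_add)
  then have "(poly_l2 q + f, hankel_poly q + f') \<in> graph" for q
    using subsetD[OF poly assms(1), of q]
    by (simp add: add.commute)
  then have "graph \<subseteq> {x. (fst x + f, snd x + f') \<in> graph}"
    by (intro graph_subset_closed[OF closed]) simp
  then show ?thesis
    using assms(2) by (auto simp: add.commute)
qed

lemma graph_scaleC:
  assumes "(f, f') \<in> graph"
  shows "(scaleC c f, scaleC (cnj c) f') \<in> graph"
proof -
  have "graph \<subseteq> {x. (scaleC c (fst x), scaleC (cnj c) (snd x)) \<in> graph}"
  proof (rule graph_subset_closed)
    show "closed {x. (scaleC c (fst x), scaleC (cnj c) (snd x)) \<in> graph}"
      using continuous_closed_vimage[OF closed_graph, of "\<lambda>x. (scaleC c (fst x), scaleC (cnj c) (snd x))"]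
      by (simp add: vimage_def continuous_intros bounded_linear.isCont[OF bounded_linear_scaleC])
  qed (simp add: poly_in_graph flip: poly_l2_smult hankel_poly_smult)
  with assms show ?thesis by auto
qed

lemma graph_diff:
  assumes "(f, f') \<in> graph" "(g, g') \<in> graph"
  shows "(f - g, f' - g') \<in> graph"
  using graph_add[OF assms(1) graph_scaleC[OF assms(2), of "-1"]] by simp

lemma graph_shift:
  assumes "(f, f') \<in> graph"
  shows "(shift f, shift_adj f') \<in> graph"
proof -
  have "graph \<subseteq> {x. (shift (fst x), shift_adj (snd x)) \<in> graph}"
  proof (rule graph_subset_closed)
    show "closed {x. (shift (fst x), shift_adj (snd x)) \<in> graph}"
      using continuous_closed_vimage[OF closed_graph, of "\<lambda>x. (shift (fst x), shift_adj (snd x))"]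
      by (simp add: vimage_def continuous_intros bounded_linear.isCont[OF bounded_linear_shift]
          bounded_linear.isCont[OF bounded_linear_shift_adj])
  qed (simp add: poly_in_graph flip: poly_l2_shift hankel_poly_shift)
  with assms show ?thesis by auto
qed

lemma graph_hardy:
  assumes "(f, f') \<in> graph"
  shows "f \<in> hardy" "f' \<in> hardy"
proof -
  have "graph \<subseteq> hardy \<times> hardy"
    by (intro graph_subset_closed closed_Times hardy.closed) (simp add: poly_l2_hardy hankel_poly_hardy)
  with assms show "f \<in> hardy" "f' \<in> hardy" by auto
qed

lemma graph_symmetric:
  assumes "(f, f') \<in> graph" "(g, g') \<in> graph"
  shows "cinner f' g = cinner g' f"
proof -
  have closed: "closed {x. cinner (snd x) a = cinner b (fst x)}" for a b
    by (intro closed_Collect_eq continuous_intros)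
  have poly: "graph \<subseteq> {x. cinner (snd x) (poly_l2 q) = cinner (hankel_poly q) (fst x)}" for q
    by (rule graph_subset_closed[OF closed]) (simp add: cinner_hankel_poly)
  have "cinner (hankel_poly q) f = cinner f' (poly_l2 q)" for q
    using subsetD[OF poly assms(1), of q] by simp
  then have "graph \<subseteq> {x. cinner (snd x) f = cinner f' (fst x)}"
    by (intro graph_subset_closed[OF closed]) simp
  then show ?thesis
    using assms(2) by auto
qed

text \<open>Closability: \<open>(0, g - g')\<close> lies in the graph, and symmetry against the pair
  of a monomial makes each nonnegative coefficient of \<open>g - g'\<close> equal to an inner
  product with 0.\<close>

lemma graph_single_valued:
  assumes "(f, g) \<in> graph" "(f, g') \<in> graph"
  shows "g = g'"
proof (rule hardy_eqI)
  fix n :: int assume "0 \<le> n"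
  have "cinner (g - g') (poly_l2 (monom 1 (nat n))) = 0"
    using graph_symmetric[OF graph_diff[OF assms] poly_in_graph] by simp
  with \<open>0 \<le> n\<close> show "cinner g (monomial n) = cinner g' (monomial n)"
    by (simp add: poly_l2_monom cinner_diff_left)
qed (use assms graph_hardy in auto)

lemma hankel_eq: "(f, g) \<in> graph \<Longrightarrow> hankel u f = g"
  unfolding hankel_def graph_def[symmetric] using graph_single_valued by auto

text \<open>Makes \<open>(f, hankel u f) \<in> graph\<close> the test for \<open>f\<close> being in
  the domain. It separates a genuine value 0 from the default value 0.\<close>

lemma hankel_in_graph: "(f, g) \<in> graph \<Longrightarrow> (f, hankel u f) \<in> graph"
  using hankel_eq by simp

lemma hankel_eq_0: "(f, hankel u f) \<notin> graph \<Longrightarrow> hankel u f = 0"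
  using hankel_in_graph unfolding hankel_def graph_def[symmetric] by auto

lemma hankel_poly_l2: "hankel u (poly_l2 p) = hankel_poly p"
  by (rule hankel_eq[OF poly_in_graph])

lemma csubspace_range_hankel_poly: "l2.subspace (range hankel_poly)"
  unfolding l2.subspace_def
proof (intro conjI ballI allI)
  show "0 \<in> range hankel_poly"
    by (metis hankel_poly_0 rangeI)
  show "x + y \<in> range hankel_poly" if "x \<in> range hankel_poly" "y \<in> range hankel_poly" for x y
    using that by (auto simp flip: hankel_poly_add)
  show "scaleC c x \<in> range hankel_poly" if "x \<in> range hankel_poly" for c x
  proof -
    obtain p where "x = hankel_poly p"
      using \<open>x \<in> range hankel_poly\<close> by auto
    then have "scaleC c x = hankel_poly (smult (cnj c) p)"
      by (simp add: hankel_poly_smult)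
    then show ?thesis by auto
  qed
qed

lemma graph_snd: "(f, g) \<in> graph \<Longrightarrow> g \<in> closure (range hankel_poly)"
proof -
  have "graph \<subseteq> {x. snd x \<in> closure (range hankel_poly)}"
  proof (rule graph_subset_closed)
    show "closed {x :: l2 \<times> l2. snd x \<in> closure (range hankel_poly)}"
      using continuous_closed_vimage[OF closed_closure, of snd] by (simp add: vimage_def continuous_intros)
  qed (auto intro: closure_subset[THEN subsetD])
  then show "(f, g) \<in> graph \<Longrightarrow> g \<in> closure (range hankel_poly)" by auto
qed

lemma hankel_in_closure: "hankel u f \<in> closure (range hankel_poly)"
  using graph_snd hankel_eq_0 l2.subspace_0[OF csubspace_closure[OF csubspace_range_hankel_poly]] by metis

text \<open>Each value of \<open>hankel u\<close> is a limit of images of polynomials or the default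
  0, so these images are dense in the range and closed conditions on it can be checked on
  them.\<close>

lemma hankel_range_eq: "hankel_range u = closure (range hankel_poly)"
proof
  show "hankel_range u \<subseteq> closure (range hankel_poly)"
    unfolding hankel_range_def by (intro closure_minimal) (auto simp: hankel_in_closure)
  have "range hankel_poly \<subseteq> hankel u ` hardy"
    using hankel_poly_l2 poly_l2_hardy by (metis image_eqI image_subsetI)
  then show "closure (range hankel_poly) \<subseteq> hankel_range u"
    unfolding hankel_range_def by (rule closure_mono)
qed

lemma closed_csubspace_hankel_range: "closed_csubspace (hankel_range u)"
  unfolding hankel_range_eq
  by (simp add: closed_csubspace_def csubspace_closure csubspace_range_hankel_poly)

sublocale X: closed_csubspace "hankel_range u"
  by (rule closed_csubspace_hankel_range)

lemma hankel_in_range: "hankel u f \<in> hankel_range u"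
  by (simp add: hankel_range_eq hankel_in_closure)

lemma hankel_poly_in_range: "hankel_poly p \<in> hankel_range u"
  using hankel_in_range[of "poly_l2 p"] by (simp add: hankel_poly_l2)

lemma symbol_in_range: "u \<in> hankel_range u"
  using hankel_poly_in_range[of 1] by (simp add: hankel_poly_1)

lemma hankel_range_hardy: "hankel_range u \<subseteq> hardy"
  unfolding hankel_range_eq using hankel_poly_hardy hardy.closed by (intro closure_minimal) auto

lemma hankel_range_minimal:
  "closed V \<Longrightarrow> (\<And>p. hankel_poly p \<in> V) \<Longrightarrow> hankel_range u \<subseteq> V"
  unfolding hankel_range_eq by (intro closure_minimal) auto

lemma shift_adj_in_range:
  assumes "f \<in> hankel_range u"
  shows "shift_adj f \<in> hankel_range u"
proof -
  have "hankel_range u \<subseteq> shift_adj -` hankel_range u"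
  proof (rule hankel_range_minimal)
    show "closed (shift_adj -` hankel_range u)"
      by (intro continuous_closed_vimage X.closed bounded_linear.isCont[OF bounded_linear_shift_adj]) simp
  qed (simp add: hankel_poly_in_range flip: hankel_poly_shift)
  with assms show ?thesis by auto
qed

section \<open>Squares on the closed range, inside and outside the domain\<close>

lemma hankel_ess_square:
  "f \<in> hankel_range u \<Longrightarrow> (hankel_ess u ^^ 2) f = (hankel u ^^ 2) f"
  by (simp add: hankel_ess_def numeral_2_eq_2 hankel_in_range)

lemma hankel_shifted_in_range: "hankel_shifted u f \<in> hankel_range u"
  by (simp add: hankel_shifted_def hankel_in_range shift_adj_in_range)

lemma hankel_shifted_ess_square:
  "f \<in> hankel_range u \<Longrightarrow> (hankel_shifted_ess u ^^ 2) f = (hankel_shifted u ^^ 2) f"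
  by (simp add: hankel_shifted_ess_def numeral_2_eq_2 hankel_shifted_in_range)

lemma square_in_range:
  "(hankel u ^^ 2) f \<in> hankel_range u" "(hankel_shifted u ^^ 2) f \<in> hankel_range u"
  by (simp_all add: numeral_2_eq_2 hankel_in_range hankel_shifted_in_range)

lemma cyclic_subspace_ess:
  assumes "v \<in> hankel_range u"
  shows "cyclic_subspace (hankel_ess u ^^ 2) v = cyclic_subspace (hankel u ^^ 2) v"
    and "cyclic_subspace (hankel_shifted_ess u ^^ 2) v = cyclic_subspace (hankel_shifted u ^^ 2) v"
  by (rule cyclic_subspace_cong[OF _ _ assms]; simp add: hankel_ess_square
      hankel_shifted_ess_square square_in_range)+

text \<open>Translation by a vector \<open>f0\<close> outside the domain carries every vector of the
  domain out of it, where the default value makes the square 0. Additivity of the square on the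
  range then makes it 0 on the original vector too.\<close>

lemma hankel_range_subset_span_symbol:
  assumes sa: "bounded_selfadjoint_on (hankel_range u) (hankel_ess u ^^ 2)"
    and cyclic: "cyclic_subspace (hankel u ^^ 2) v = hankel_range u"
    and f0: "f0 \<in> hankel_range u" "(f0, hankel u f0) \<notin> graph"
  shows "hankel_range u \<subseteq> closure (cspan {u})"
proof -
  have not_dom: "(hankel u ^^ 2) f = 0" if "(f, hankel u f) \<notin> graph" for f
    using hankel_eq_0[OF that] hankel_eq[OF zero_in_graph] by (simp add: numeral_2_eq_2)
  have zero: "(hankel u ^^ 2) f = 0" if f: "f \<in> hankel_range u" for f
  proof (cases "(f, hankel u f) \<in> graph")
    case True
    have "(f + f0, hankel u (f + f0)) \<notin> graph"
      using graph_diff[OF _ True, of "f + f0"] hankel_in_graph f0(2) by force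
    then have "0 = (hankel u ^^ 2) (f + f0)"
      by (simp add: not_dom)
    also have "\<dots> = (hankel u ^^ 2) f + (hankel u ^^ 2) f0"
    proof -
      have "(hankel_ess u ^^ 2) (f + f0) = (hankel_ess u ^^ 2) f + (hankel_ess u ^^ 2) f0"
        using sa f f0(1) unfolding bounded_selfadjoint_on_def by blast
      then show ?thesis
        using f f0(1) by (simp add: hankel_ess_square l2.subspace_add[OF X.csubspace])
    qed
    finally show ?thesis
      by (simp add: not_dom[OF f0(2)])
  qed (rule not_dom)
  have v: "v \<in> hankel_range u"
    using power_in_cyclic_subspace[of 0 "hankel u ^^ 2" v] cyclic by simp
  have range_v: "hankel_range u \<subseteq> closure (cspan {v})"
  proof -
    have "((hankel u ^^ 2) ^^ n) v \<in> cspan {v}" for n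
    proof (cases n)
      case (Suc m)
      have "((hankel u ^^ 2) ^^ n) v = ((hankel u ^^ 2) ^^ m) 0"
        unfolding Suc funpow_Suc_right by (simp add: zero[OF v])
      also have "\<dots> = 0"
        using zero[OF l2.subspace_0[OF X.csubspace]] by (induction m) simp_all
      finally show ?thesis
        by (simp add: l2.span_zero)
    qed (simp add: l2.span_base)
    then have "cyclic_subspace (hankel u ^^ 2) v \<subseteq> closure (cspan {v})"
      using closure_subset[of "cspan {v}"] unfolding cyclic_subspace_def
      by (intro closure_cspan_minimal csubspace_closure_cspan) auto
    then show ?thesis
      by (simp add: cyclic)
  qed
  have "v \<in> closure (cspan {u})"
  proof (cases "v = 0")
    case False
    \<comment> \<open>Being a multiple of \<open>v\<close>, written without division as a closed
      linear condition.\<close>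
    let ?W = "{f. scaleC (cinner v v) f = scaleC (cinner f v) v}"
    have "closure (cspan {v}) \<subseteq> ?W"
    proof (rule closure_cspan_minimal)
      show "l2.subspace ?W"
        by (simp add: l2.subspace_def cinner_add_left cinner_scaleC_left l2.scale_left_distrib
            l2.scale_right_distrib mult.commute) (metis l2.scale_scale mult.commute)
      have "bounded_linear (\<lambda>f. scaleC (cinner f v) v)"
      proof (rule bounded_linear_intro[where K = "norm v * norm v"])
        show "norm (scaleC (cinner f v) v) \<le> norm f * (norm v * norm v)" for f
          using norm_cinner_le[of f v] mult_right_mono[of _ _ "norm v"]
          by (simp add: norm_scaleC flip: mult.assoc)
      qed (simp_all add: cinner_add_left l2.scale_left_distrib cinner_scaleC_left flip: scaleC_of_real)
      then show "closed ?W"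
        by (intro closed_Collect_eq linear_continuous_on bounded_linear_scaleC)
    qed simp
    then have u: "scaleC (cinner v v) u = scaleC (cinner u v) v"
      using range_v symbol_in_range by blast
    show ?thesis
    proof (cases "cinner u v = 0")
      case True
      \<comment> \<open>If \<open>u\<close> is 0, all vectors S^{*n} u vanish and so does the range,
        although it contains the nonzero \<open>v\<close>.\<close>
      with u False have "u = 0"
        by (simp add: cinner_self_eq_0_iff)
      have "hankel_poly p = 0" for p
      proof (induction p)
        case (pCons a p)
        show ?case
          unfolding hankel_poly_pCons pCons.IH
          by (simp add: \<open>u = 0\<close> linear_0[OF bounded_linear.linear[OF bounded_linear_shift_adj]])
      qed (rule hankel_poly_0)
      then have "hankel_range u \<subseteq> {0}"
        by (intro hankel_range_minimal) auto
      with v False show ?thesis by auto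
    next
      case nz: False
      have "v = scaleC (inverse (cinner u v) * cinner v v) u"
        using arg_cong[OF u, of "scaleC (inverse (cinner u v))"] nz by simp
      then have "v \<in> cspan {u}"
        by (metis l2.span_base l2.span_scale singletonI)
      then show ?thesis
        using closure_subset by blast
    qed
  qed (simp add: l2.subspace_0[OF csubspace_closure_cspan])
  then have "closure (cspan {v}) \<subseteq> closure (cspan {u})"
    by (intro closure_cspan_minimal csubspace_closure_cspan) auto
  with range_v show ?thesis by simp
qed

text \<open>Symmetry gives <H f, H f> = <H (H f), f>, provided \<open>f\<close> and
  \<open>H f\<close> are both in the domain; this is why \<open>dom\<close> covers the whole range.
  The absolute value covers a negative \<open>C\<close>, possible when the range is {0}.\<close>

lemma norm_hankel_le:
  assumes dom: "\<And>f. f \<in> hankel_range u \<Longrightarrow> (f, hankel u f) \<in> graph"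
    and C: "\<And>f. f \<in> hankel_range u \<Longrightarrow> norm ((hankel u ^^ 2) f) \<le> C * norm f"
    and f: "f \<in> hankel_range u"
  shows "norm (hankel u f) \<le> sqrt \<bar>C\<bar> * norm f"
proof (rule power2_le_imp_le)
  have "complex_of_real ((norm (hankel u f))\<^sup>2) = cinner (hankel u (hankel u f)) f"
    unfolding cinner_self[symmetric] by (rule graph_symmetric[OF dom[OF f] dom[OF hankel_in_range]])
  then have "(norm (hankel u f))\<^sup>2 \<le> norm ((hankel u ^^ 2) f) * norm f"
    using norm_cinner_le[of "hankel u (hankel u f)" f]
    by (metis abs_power2 funpow_0 funpow_Suc_right numeral_2_eq_2 norm_of_real o_apply)
  also have "\<dots> \<le> (\<bar>C\<bar> * norm f) * norm f"
    using C[OF f] mult_right_mono[OF abs_ge_self[of C] norm_ge_zero[of f]]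
    by (intro mult_right_mono) auto
  also have "\<dots> = (sqrt \<bar>C\<bar> * norm f)\<^sup>2"
    by (simp add: power2_eq_square)
  finally show "(norm (hankel u f))\<^sup>2 \<le> (sqrt \<bar>C\<bar> * norm f)\<^sup>2" .
qed simp

lemma cyclic_subspace_symbol:
  assumes dom: "\<And>f. f \<in> hankel_range u \<Longrightarrow> (f, hankel u f) \<in> graph"
    and C: "\<And>f. f \<in> hankel_range u \<Longrightarrow> norm ((hankel u ^^ 2) f) \<le> C * norm f"
    and v: "v \<in> hankel_range u" "cyclic_subspace (hankel u ^^ 2) v = hankel_range u"
    and w: "w \<in> hankel_range u" "cyclic_subspace (hankel_shifted u ^^ 2) w = hankel_range u"
  shows "cyclic_subspace (hankel u ^^ 2) u = hankel_range u"
    and "cyclic_subspace (hankel_shifted u ^^ 2) u = hankel_range u"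
proof -
  let ?X = "hankel_range u"
  \<comment> \<open>The projection extends H from the range to a bounded operator on all of
    \<open>l2\<close>, as \<open>symmetric_antilinear\<close> requires. Symmetry survives because
    the values stay in the range.\<close>
  define K where "K f = hankel u (orth_proj ?X f)" for f
  define K' where "K' f = shift_adj (K f)" for f
  have K_X: "K f = hankel u f" "K' f = hankel_shifted u f" if "f \<in> ?X" for f
    using that by (simp_all add: K_def K'_def hankel_shifted_def X.orth_proj_id)
  have K_in: "K f \<in> ?X" "K' f \<in> ?X" for f
    by (simp_all add: K_def K'_def hankel_in_range shift_adj_in_range)
  have dom_P: "(orth_proj ?X f, K f) \<in> graph" for f
    unfolding K_def by (rule dom[OF X.orth_proj_in])
  have K_sym: "cinner (K f) g = cinner (K g) f" for f g
    using graph_symmetric[OF dom_P[of f] dom_P[of g]] by (simp add: X.cinner_orth_proj' K_in)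
  have K_bd: "norm (K f) \<le> sqrt \<bar>C\<bar> * norm f" for f
  proof -
    have "norm (K f) \<le> sqrt \<bar>C\<bar> * norm (orth_proj ?X f)"
      unfolding K_def by (rule norm_hankel_le[OF dom C X.orth_proj_in])
    also have "\<dots> \<le> sqrt \<bar>C\<bar> * norm f"
      by (intro mult_left_mono X.norm_orth_proj_le) simp
    finally show ?thesis .
  qed
  interpret K: symmetric_antilinear K "sqrt \<bar>C\<bar>"
    by unfold_locales (fact K_sym K_bd)+
  have P_hardy: "orth_proj ?X f \<in> hardy" for f
    using X.orth_proj_in hankel_range_hardy by blast
  have K'_sym: "cinner (K' f) g = cinner (K' g) f" for f g
  proof -
    have "cinner (K' f) (orth_proj ?X g) = cinner (K' g) (orth_proj ?X f)"
      using graph_symmetric[OF graph_shift[OF dom_P[of f]] dom_P[of g]]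
      by (simp add: K'_def cinner_shift_adj P_hardy)
    then show ?thesis
      by (simp add: X.cinner_orth_proj' K_in)
  qed
  have norm_shift_adj: "norm (shift_adj f) \<le> norm f" for f
    using hardy.norm_orth_proj_le[of "unshift f"] by (simp add: shift_adj_eq riesz_proj_eq norm_unshift)
  have K'_bd: "norm (K' f) \<le> sqrt \<bar>C\<bar> * norm f" for f
    unfolding K'_def by (rule order_trans[OF norm_shift_adj K_bd])
  interpret K': symmetric_antilinear K' "sqrt \<bar>C\<bar>"
    by unfold_locales (fact K'_sym K'_bd)+
  \<comment> \<open>With h = H f, the vector S S^* h = h - c 1 may leave the range, so its image is
    found in the graph in two ways: by subtraction, where antilinearity conjugates \<open>c\<close>,
    and as S^* H applied to S^* h.\<close>
  have squares: "K' (K' f) = K (K f) - scaleC (cinner f u) u" if f: "f \<in> ?X" for f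
  proof -
    define h c where "h = K f" and "c = cinner h (monomial 0)"
    have h: "h \<in> ?X"
      by (simp add: h_def K_in)
    have "c = cinner u f"
      unfolding c_def h_def K_X(1)[OF f] by (rule graph_symmetric[OF dom[OF f] monomial_0_in_graph])
    then have c: "cnj c = cinner f u"
      by (simp add: cinner_commute[of f u])
    have "(h - scaleC c (monomial 0), hankel u h - scaleC (cnj c) u) \<in> graph"
      by (rule graph_diff[OF dom[OF h] graph_scaleC[OF monomial_0_in_graph]])
    then have "(shift (shift_adj h), hankel u h - scaleC (cnj c) u) \<in> graph"
      using shift_shift_adj[of h] h hankel_range_hardy by (auto simp: c_def)
    moreover have "(shift (shift_adj h), shift_adj (hankel u (shift_adj h))) \<in> graph"
      by (rule graph_shift[OF dom[OF shift_adj_in_range[OF h]]])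
    ultimately have "shift_adj (hankel u (shift_adj h)) = hankel u h - scaleC (cnj c) u"
      by (rule graph_single_valued[rotated])
    then show ?thesis
      using h shift_adj_in_range[OF h] by (simp add: K'_def K_X c flip: h_def)
  qed
  have cyclic: "cyclic_subspace (\<lambda>f. K (K f)) f = cyclic_subspace (hankel u ^^ 2) f"
    "cyclic_subspace (\<lambda>f. K' (K' f)) f = cyclic_subspace (hankel_shifted u ^^ 2) f" if "f \<in> ?X" for f
    by (rule cyclic_subspace_cong[OF _ _ that];
        simp add: numeral_2_eq_2 K_in K_X hankel_in_range hankel_shifted_in_range)+
  define M where "M = cyclic_subspace (\<lambda>f. K (K f)) u"
  interpret M: closed_csubspace M
    unfolding M_def by (rule closed_csubspace_cyclic_subspace)
  have u_M: "u \<in> M"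
    unfolding M_def using power_in_cyclic_subspace[of 0 "\<lambda>f. K (K f)" u] by simp
  have "(\<lambda>f. K (K f)) ` M \<subseteq> M"
    unfolding M_def by (rule cyclic_subspace_invariant[OF K.bounded_linear_square]) (simp add: K.scaleC)
  then have inv: "K (K f) \<in> M" if "f \<in> M" for f
    using that by blast
  have M_X: "M \<subseteq> ?X"
    unfolding M_def
    by (rule cyclic_subspace_minimal[OF closed_csubspace_hankel_range symbol_in_range]) (auto simp: K_in)
  have inv': "K' (K' f) \<in> M" if "f \<in> M" for f
    unfolding squares[OF subsetD[OF M_X that]]
    by (intro l2.subspace_diff l2.subspace_scale M.csubspace inv that u_M)
  \<comment> \<open>On the range the two squares differ by a multiple of \<open>u\<close>, so a
    subspace of it that contains \<open>u\<close> and is invariant under one is invariant under the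
    other.\<close>
  have M_eq: "cyclic_subspace (\<lambda>f. K' (K' f)) u = M"
  proof
    show "cyclic_subspace (\<lambda>f. K' (K' f)) u \<subseteq> M"
      using inv' u_M by (intro cyclic_subspace_minimal M.closed_csubspace_axioms) auto
    let ?M' = "cyclic_subspace (\<lambda>f. K' (K' f)) u"
    interpret M': closed_csubspace ?M'
      by (rule closed_csubspace_cyclic_subspace)
    have u_M': "u \<in> ?M'"
      using power_in_cyclic_subspace[of 0 "\<lambda>f. K' (K' f)" u] by simp
    have M'_inv: "(\<lambda>f. K' (K' f)) ` ?M' \<subseteq> ?M'"
      by (rule cyclic_subspace_invariant[OF K'.bounded_linear_square]) (simp add: K'.scaleC)
    have "K (K f) \<in> ?M'" if f: "f \<in> ?M'" for f
    proof -
      have "K' (K' f) \<in> ?M'"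
        using M'_inv f by blast
      moreover have "f \<in> ?X"
        using f \<open>?M' \<subseteq> M\<close> M_X by blast
      then have "K (K f) = K' (K' f) + scaleC (cinner f u) u"
        by (simp add: squares)
      ultimately show ?thesis
        using u_M' M'.csubspace by (simp add: l2.subspace_add l2.subspace_scale)
    qed
    then show "M \<subseteq> ?M'"
      unfolding M_def using u_M' by (intro cyclic_subspace_minimal M'.closed_csubspace_axioms) auto
  qed
  \<comment> \<open>Simplicity for the first square enters here through \<open>v\<close>, and for
    the second one below through \<open>w\<close>.\<close>
  have K_M: "K f \<in> M" if "f \<in> M" for f
  proof (rule K.invariant_subspace[OF M.closed_csubspace_axioms inv _ that])
    show "M \<subseteq> cyclic_subspace (\<lambda>f. K (K f)) v" "K f \<in> cyclic_subspace (\<lambda>f. K (K f)) v"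
      unfolding cyclic(1)[OF v(1)] v(2) by (fact M_X K_in)+
  qed
  have K'_M: "K' f \<in> M" if "f \<in> M" for f
  proof (rule K'.invariant_subspace[OF M.closed_csubspace_axioms inv' _ that])
    show "M \<subseteq> cyclic_subspace (\<lambda>f. K' (K' f)) w" "K' f \<in> cyclic_subspace (\<lambda>f. K' (K' f)) w"
      unfolding cyclic(2)[OF w(1)] w(2) by (fact M_X K_in)+
  qed
  \<comment> \<open>By symmetry a vector killed by \<open>K\<close> is orthogonal to all images of
    polynomials, hence to the range that contains it.\<close>
  have inj: "f = 0" if f: "f \<in> ?X" "K f = 0" for f
  proof -
    have "cinner (hankel_poly p) f = 0" for p
      using graph_symmetric[OF poly_in_graph dom[OF f(1)]] f by (simp add: K_X)
    then have "?X \<subseteq> {g. cinner g f = 0}"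
      by (intro hankel_range_minimal closed_Collect_eq continuous_intros) auto
    with f(1) show ?thesis
      by (auto simp: cinner_self_eq_0_iff)
  qed
  \<comment> \<open>S^* is controlled only on vectors \<open>K f\<close>, where it gives
    \<open>K' f\<close>. Reaching all of \<open>M\<close> requires the image of \<open>M\<close>
    under \<open>K\<close> to be dense in \<open>M\<close>.\<close>
  define V where "V = closure (cspan (K ` M))"
  interpret V: closed_csubspace V
    unfolding V_def by (rule closed_csubspace_closure_cspan)
  have K_V: "K f \<in> V" if "f \<in> M" for f
    unfolding V_def using that by (intro closure_subset[THEN subsetD] l2.span_base imageI)
  have V_M: "V \<subseteq> M"
    unfolding V_def using K_M by (intro closure_cspan_minimal M.csubspace M.closed) auto
  have M_V: "M \<subseteq> V"
  proof
    fix f assume f: "f \<in> M"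
    define y where "y = f - orth_proj V f"
    have y: "y \<in> M"
      unfolding y_def using f V_M V.orth_proj_in M.csubspace by (intro l2.subspace_diff) auto
    have "cinner (K y) m = 0" if "m \<in> M" for m
    proof -
      have "cinner y (K m) = 0"
        unfolding y_def by (rule V.orth_proj_orth[OF K_V[OF that]])
      then show ?thesis
        using cinner_commute[of "K m" y] K_sym[of y m] by simp
    qed
    \<comment> \<open>The orthogonality is used with \<open>m\<close> equal to \<open>K y\<close>,
      which lies in \<open>M\<close> by invariance; this forces \<open>K y\<close> to be 0.\<close>
    from this[OF K_M[OF y]] have "y = 0"
      using inj y M_X by (auto simp: cinner_self_eq_0_iff)
    then show "f \<in> V"
      using V.orth_proj_in[of f] by (simp add: y_def)
  qed
  have S_M: "shift_adj f \<in> M" if "f \<in> M" for f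
  proof -
    have "V \<subseteq> shift_adj -` M"
      unfolding V_def
    proof (rule closure_cspan_minimal)
      show "l2.subspace (shift_adj -` M)"
        using M.csubspace linear_0[OF bounded_linear.linear[OF bounded_linear_shift_adj]]
          linear_add[OF bounded_linear.linear[OF bounded_linear_shift_adj]]
        by (auto simp: l2.subspace_def shift_adj_scaleC)
      show "closed (shift_adj -` M)"
        by (intro continuous_closed_vimage M.closed bounded_linear.isCont[OF bounded_linear_shift_adj]) simp
      show "K ` M \<subseteq> shift_adj -` M"
        using K'_M by (auto simp: K'_def)
    qed
    with that M_V show ?thesis by auto
  qed
  have "hankel_poly p \<in> M" for p
  proof (induction p)
    case 0
    show ?case
      by (simp add: hankel_poly_0 l2.subspace_0[OF M.csubspace])
  next
    case (pCons a p)
    then show ?case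
      unfolding hankel_poly_pCons
      by (intro l2.subspace_add l2.subspace_scale M.csubspace u_M S_M)
  qed
  then have "M = ?X"
    using M_X hankel_range_minimal[OF M.closed] by blast
  then show "cyclic_subspace (hankel u ^^ 2) u = ?X" "cyclic_subspace (hankel_shifted u ^^ 2) u = ?X"
    using cyclic[OF symbol_in_range] M_eq M_def by simp_all
qed

end

theorem theorem1p1:
  fixes u :: l2
  assumes "u \<in> BMOA_simp"
  shows "cyclic_vector (hankel_range u) (hankel_ess u ^^ 2) u \<and>
    cyclic_vector (hankel_range u) (hankel_shifted_ess u ^^ 2) u \<and>
    cyclic_subspace (hankel u ^^ 2) u = cyclic_subspace (hankel_shifted u ^^ 2) u \<and>
    cyclic_subspace (hankel_shifted u ^^ 2) u = hankel_range u"
proof -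
  interpret hankel_symbol u
    using assms by unfold_locales (simp add: BMOA_simp_def BMOA_def)
  let ?X = "hankel_range u"
  from assms have sa: "bounded_selfadjoint_on ?X (hankel_ess u ^^ 2)"
    and "\<exists>v. cyclic_vector ?X (hankel_ess u ^^ 2) v" "\<exists>w. cyclic_vector ?X (hankel_shifted_ess u ^^ 2) w"
    by (simp_all add: BMOA_simp_def simple_spectrum_def)
  then obtain v w where v: "v \<in> ?X" "cyclic_subspace (hankel u ^^ 2) v = ?X"
    and w: "w \<in> ?X" "cyclic_subspace (hankel_shifted u ^^ 2) w = ?X"
    by (auto simp: cyclic_vector_def cyclic_subspace_ess)
  have "cyclic_subspace (hankel u ^^ 2) u = ?X \<and> cyclic_subspace (hankel_shifted u ^^ 2) u = ?X"
  \<comment> \<open>Either the closed operator is defined on the whole closed range, and is then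
    bounded there, or the range is at most a line.\<close>
  proof (cases "\<forall>f\<in>?X. (f, hankel u f) \<in> graph")
    case True
    obtain C where "\<forall>f\<in>?X. norm ((hankel_ess u ^^ 2) f) \<le> C * norm f"
      using sa by (auto simp: bounded_selfadjoint_on_def)
    then have "norm ((hankel u ^^ 2) f) \<le> C * norm f" if "f \<in> ?X" for f
      using that by (simp add: hankel_ess_square)
    from cyclic_subspace_symbol[OF _ this v w] True show ?thesis
      by blast
  next
    case False
    then have "?X \<subseteq> closure (cspan {u})"
      using hankel_range_subset_span_symbol[OF sa v(2)] by blast
    \<comment> \<open>\<open>u\<close> is the zeroth vector of its own orbit, so its cyclic subspace
      contains the line through it, whatever \<open>A\<close> is.\<close>
    moreover have "closure (cspan {u}) \<subseteq> cyclic_subspace A u" for A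
      using closed_csubspace_cyclic_subspace[of A u] power_in_cyclic_subspace[of 0 A u]
      by (intro closure_cspan_minimal) (auto simp: closed_csubspace_def)
    moreover have "cyclic_subspace (hankel u ^^ 2) u \<subseteq> ?X" "cyclic_subspace (hankel_shifted u ^^ 2) u \<subseteq> ?X"
      by (intro cyclic_subspace_minimal closed_csubspace_hankel_range symbol_in_range;
          use square_in_range in blast)+
    ultimately show ?thesis by blast
  qed
  then show ?thesis
    by (simp add: cyclic_vector_def cyclic_subspace_ess symbol_in_range)
qed

end
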